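(* Let $(a_n)_{n\in\mathbb{N}}\subset\mathbb{C}$ be a linear sequence. Then there exist an almost periodic sequence $(b_n)_{n\in\mathbb{N}}\subset\mathbb{C}$ and a bounded sequence $(c_n)_{n\in\mathbb{N}}\subset\mathbb{C}$ with $$\lim_{N\to\infty}\frac1N\sum_{n=1}^N|c_n|=0$$ such that $a_n=b_n+c_n$ for every $n\in\mathbb{N}$.
   Context: A bounded linear operator $T$ on a Banach space $X$ has relatively weakly compact orbits (such an operator is called relatively weakly compact) if for every $x\in X$ the orbit $\{T^nx:\ n\in\mathbb{N}_0\}$ is relatively compact in the weak topology of $X$. A sequence $(a_n)\subset\mathbb{C}$ is called a linear sequence if there exist a complex Banach space $X$, a bounded linear operator $T$ on $X$ with relatively weakly compact orbits, a vector $x\in X$ and a functional $x'\in X'$ (the dual space of $X$) such that $a_n=\langle T^nx,x'\rangle$ for every $n\in\mathbb{N}$. A sequence is almost periodic if it is a uniform (i.e. $\ell^\infty$-norm) limit of finite linear combinations of sequences of the form $(\lambda^n)_{n\in\mathbb{N}}$ with $\lambda\in\mathbb{T}=\{z\in\mathbb{C}:|z|=1\}$. Here $\mathbb{N}=\{1,2,\dots\}$ and $\mathbb{N}_0=\mathbb{N}\cup\{0\}$. *)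

theory Defs
  imports "HOL-Analysis.Analysis"
begin

class complex_normed_vector = real_normed_vector +
  fixes scaleC :: "complex \<Rightarrow> 'a \<Rightarrow> 'a"  (infixr \<open>*\<^sub>C\<close> 75)
  assumes scaleC_add_right: "c *\<^sub>C (x + y) = c *\<^sub>C x + c *\<^sub>C y"
    and scaleC_add_left: "(c + d) *\<^sub>C x = c *\<^sub>C x + d *\<^sub>C x"
    and scaleC_scaleC: "c *\<^sub>C d *\<^sub>C x = (c * d) *\<^sub>C x"
    and scaleR_scaleC: "r *\<^sub>R x = complex_of_real r *\<^sub>C x"
    and norm_scaleC: "norm (c *\<^sub>C x) = cmod c * norm x"

class complex_banach = complex_normed_vector + banach

instantiation complex :: complex_banach
begin

definition scaleC_complex :: "complex \<Rightarrow> complex \<Rightarrow> complex"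
  where "scaleC_complex = (*)"

instance
  by standard
    (simp_all only: scaleC_complex_def distrib_left distrib_right mult.assoc norm_mult scaleR_conv_of_real)

end

lemma scaleC_one: "1 *\<^sub>C (x::'a::complex_normed_vector) = x"
  using scaleR_scaleC[of 1 x] by simp

lemma vector_space_scaleC:
  "vector_space ((*\<^sub>C) :: complex \<Rightarrow> 'a::complex_normed_vector \<Rightarrow> 'a)"
  by unfold_locales (simp_all add: scaleC_add_right scaleC_add_left scaleC_scaleC scaleC_one)

definition bounded_clinear :: "('a::complex_normed_vector \<Rightarrow> 'b::complex_normed_vector) \<Rightarrow> bool"
  where "bounded_clinear f \<longleftrightarrow> bounded_linear f \<and> (\<forall>c x. f (c *\<^sub>C x) = c *\<^sub>C f x)"

definition cdual :: "('a::complex_normed_vector \<Rightarrow> complex) set"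
  where "cdual = {\<phi>. bounded_clinear \<phi>}"

definition weak_topology :: "'a::complex_normed_vector topology"
  where "weak_topology = topology_generated_by {\<phi> -` U | \<phi> U. \<phi> \<in> cdual \<and> open U}"

lemma zero_in_cdual: "(\<lambda>_. 0) \<in> cdual"
  by (simp add: cdual_def bounded_clinear_def scaleC_complex_def)

lemma topspace_weak_topology [simp]:
  "topspace (weak_topology :: 'a::complex_normed_vector topology) = UNIV"
proof -
  have "(\<lambda>_::'a. 0::complex) -` UNIV \<in> {\<phi> -` U | \<phi> U. \<phi> \<in> cdual \<and> open U}"
    using zero_in_cdual open_UNIV by blast
  then have "UNIV \<subseteq> \<Union>{\<phi> -` U | (\<phi> :: 'a \<Rightarrow> complex) U. \<phi> \<in> cdual \<and> open U}"
    unfolding vimage_UNIV by (rule Union_upper)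
  then show ?thesis
    unfolding weak_topology_def topology_generated_by_topspace by (rule top.extremum_uniqueI)
qed

definition rel_weakly_compact :: "'a::complex_normed_vector set \<Rightarrow> bool"
  where "rel_weakly_compact S \<longleftrightarrow> compactin weak_topology (weak_topology closure_of S)"

definition rel_weakly_compact_operator :: "('a::complex_banach \<Rightarrow> 'a) \<Rightarrow> bool"
  where "rel_weakly_compact_operator T \<longleftrightarrow>
    bounded_clinear T \<and> (\<forall>x. rel_weakly_compact (range (\<lambda>n. (T ^^ n) x)))"

text \<open>
  Sequences indexed by the positive integers are represented by functions on \<^typ>\<open>nat\<close>
  whose value at \<open>0\<close> is irrelevant.

  HOL cannot quantify existentially over types, so the Banach space of a linear sequence is
  a type argument. A theorem assuming \<open>linear_sequence TYPE('a) a\<close> for an arbitrary type \<open>'a\<close>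
  covers the sequences that are linear over some complex Banach space.
\<close>

definition linear_sequence :: "'a::complex_banach itself \<Rightarrow> (nat \<Rightarrow> complex) \<Rightarrow> bool"
  where "linear_sequence _ a \<longleftrightarrow>
    (\<exists>(T :: 'a \<Rightarrow> 'a) x \<phi>. rel_weakly_compact_operator T \<and> \<phi> \<in> cdual \<and>
      (\<forall>n\<ge>1. a n = \<phi> ((T ^^ n) x)))"

definition trig_polynomial :: "(nat \<Rightarrow> complex) \<Rightarrow> bool"
  where "trig_polynomial p \<longleftrightarrow>
    (\<exists>\<Lambda> k. finite \<Lambda> \<and> \<Lambda> \<subseteq> {z. cmod z = 1} \<and> (\<forall>n\<ge>1. p n = (\<Sum>z\<in>\<Lambda>. k z * z ^ n)))"

definition almost_periodic :: "(nat \<Rightarrow> complex) \<Rightarrow> bool"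
  where "almost_periodic b \<longleftrightarrow>
    (\<exists>p. (\<forall>j::nat. trig_polynomial (p j)) \<and> uniform_limit {1..} p b sequentially)"

end

theory Submission
  imports Defs
begin

text \<open>
  This is the Jacobs-de Leeuw-Glicksberg decomposition. It is usually derived from the compact
  semigroup generated by \<open>T\<close> in the weak operator topology: its minimal ideal is a group, on which
  one integrates with Haar measure. Here single ultrafilters on \<open>\<nat>\<close> take the role of that semigroup.

  Fix \<open>T\<close>, \<open>x\<close> and \<open>\<phi>\<close>. An ultrafilter \<open>U\<close> is chosen such that \<open>z ^ k\<close> tends to \<open>1\<close> along \<open>U\<close> for all \<open>z\<close> on the
  unit circle, and such that \<open>U\<close> contains all sets of density one (\<open>difference_ultrafilter\<close>). By weak
  compactness \<open>(T ^^ k) x\<close> converges weakly along \<open>U\<close> to some \<open>y\<close>, and the decomposition is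
  \<open>b n = \<phi> ((T ^^ n) y)\<close> and \<open>c n = \<phi> ((T ^^ n) (x - y))\<close>. The first property of \<open>U\<close> gives
  \<open>x\<close> and \<open>y\<close> the same Fourier coefficients, so \<open>c\<close> has none. The second shows that \<open>b\<close> is almost periodic: a
  functional \<open>\<psi>\<close> that annihilates the almost periodic part makes \<open>\<psi> ((T ^^ k) x)\<close> a sequence without Fourier
  coefficients, hence one that vanishes in density, and so \<open>\<psi> y = 0\<close>. The Hahn-Banach
  theorem (\<open>hahn_banach_cdual\<close>) concludes.

  Both halves rest on two facts about sequences that satisfy Grothendieck's iterated limit condition,
  as linear sequences do (\<open>linear_sequence_wap\<close>). First, such a sequence has a uniform mean
  (\<open>wap_uniform_mean\<close>), so that Fourier coefficients exist uniformly under shifts. Secondly, if all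
  Fourier coefficients vanish, then the absolute values have mean zero (\<open>cesaro_null_if_fourier_zero\<close>).
  The latter combines Wiener's estimate for the correlations of the sequence
  with the precompactness of its shifts in mean square.

  The iterated limit condition enters through a substitute for dominated convergence
  (\<open>mean_tendsto_zero\<close>): for invariant means, which are only finitely additive, bounded convergence at
  all ultrafilters implies convergence of the means. It follows from Bergelson's intersectivity
  lemma and takes the place of the Krein-Smulian theorem and of integration over a compact group.
\<close>

section \<open>Ultrafilter limits\<close>

definition ultrafilter :: "'a filter \<Rightarrow> bool"
  where "ultrafilter U \<longleftrightarrow> U \<noteq> bot \<and> (\<forall>P. eventually P U \<or> eventually (\<lambda>x. \<not> P x) U)"

lemma ultrafilter_not_bot: "ultrafilter U \<Longrightarrow> U \<noteq> bot"
  by (simp add: ultrafilter_def)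

lemma ultrafilter_not_eventually:
  "ultrafilter U \<Longrightarrow> (\<not> eventually P U) \<longleftrightarrow> eventually (\<lambda>x. \<not> P x) U"
proof -
  assume U: "ultrafilter U"
  have False if "eventually P U" "eventually (\<lambda>x. \<not> P x) U"
  proof -
    from that have "eventually (\<lambda>x. False) U" by eventually_elim simp
    with U show False by (simp add: ultrafilter_def)
  qed
  with U show "(\<not> eventually P U) \<longleftrightarrow> eventually (\<lambda>x. \<not> P x) U"
    unfolding ultrafilter_def by blast
qed

lemma ultrafilter_filtermap: "ultrafilter U \<Longrightarrow> ultrafilter (filtermap f U)"
  unfolding ultrafilter_def by (simp add: filtermap_bot_iff eventually_filtermap)

text \<open>
  Zorn's lemma applied to the proper filters below \<^term>\<open>F\<close>, the smaller filter being the later one.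
  The infimum of a chain of proper filters is proper because the chain is a base of it.
\<close>

lemma ultrafilter_exists:
  assumes "F \<noteq> (bot :: 'a filter)"
  obtains U where "U \<le> F" "ultrafilter U"
proof -
  define A where "A = {G. G \<le> F \<and> G \<noteq> bot}"
  have po: "partial_order_on A (relation_of (\<lambda>x y. y \<le> x) A)"
    by (rule partial_order_on_relation_ofI) auto
  have ch: "\<exists>u\<in>A. \<forall>a\<in>C. u \<le> a" if C: "C \<in> Chains (relation_of (\<lambda>x y. y \<le> x) A)" for C
  proof (cases "C = {}")
    case True
    then show ?thesis using assms by (auto simp: A_def)
  next
    case False
    have CA: "C \<subseteq> A" using C unfolding Chains_def relation_of_def by blast
    have tot: "x \<le> y \<or> y \<le> x" if "x \<in> C" "y \<in> C" for x y
      using C that unfolding Chains_def relation_of_def by blast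
    have "eventually P (Inf C) \<longleftrightarrow> (\<exists>b\<in>C. eventually P b)" for P
      by (rule eventually_Inf_base[OF False]) (use tot in \<open>force\<close>)
    then have "Inf C \<noteq> bot"
      using CA by (auto simp: A_def trivial_limit_def)
    moreover have "Inf C \<le> F" using False CA by (auto simp: A_def intro: Inf_lower2)
    ultimately show ?thesis by (intro bexI[of _ "Inf C"]) (auto simp: A_def intro: Inf_lower)
  qed
  from predicate_Zorn[OF po ch] obtain U where U: "U \<in> A" "\<And>G. G \<in> A \<Longrightarrow> G \<le> U \<Longrightarrow> G = U"
    by auto
  have "eventually P U" if "\<not> eventually (\<lambda>x. \<not> P x) U" for P
  proof -
    have "inf U (principal {x. P x}) \<noteq> bot"
      using that by (simp add: trivial_limit_def eventually_inf_principal)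
    then have "inf U (principal {x. P x}) \<in> A"
      using U(1) by (auto simp: A_def intro: le_infI1)
    then have "inf U (principal {x. P x}) = U" by (intro U(2)) auto
    moreover have "eventually P (inf U (principal {x. P x}))"
      by (simp add: eventually_inf_principal)
    ultimately show ?thesis by simp
  qed
  then have "ultrafilter U" using U(1) by (auto simp: ultrafilter_def A_def)
  with U(1) that show thesis by (auto simp: A_def)
qed

lemma ultrafilter_convergent:
  fixes f :: "'a \<Rightarrow> 'b::heine_borel"
  assumes U: "ultrafilter U" and b: "bounded (range f)"
  shows "(f \<longlongrightarrow> Lim U f) U"
proof -
  have "compact (closure (range f))" using b by (simp add: compact_closure)
  moreover have "filtermap f U \<noteq> bot" using U by (simp add: filtermap_bot_iff ultrafilter_def)
  moreover have "eventually (\<lambda>x. x \<in> closure (range f)) (filtermap f U)"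
    by (simp add: eventually_filtermap closure_subset[THEN subsetD])
  ultimately obtain l where l: "inf (nhds l) (filtermap f U) \<noteq> bot"
    unfolding compact_filter by blast
  have "(f \<longlongrightarrow> l) U"
  proof (rule topological_tendstoI)
    fix S assume S: "open S" "l \<in> S"
    show "eventually (\<lambda>x. f x \<in> S) U"
    proof (rule ccontr)
      assume "\<not> ?thesis"
      then have "eventually (\<lambda>x. f x \<notin> S) U" using U by (simp add: ultrafilter_not_eventually)
      then have "eventually (\<lambda>y. y \<notin> S) (filtermap f U)" by (simp add: eventually_filtermap)
      moreover have "eventually (\<lambda>y. y \<in> S) (nhds l)" using S by (rule eventually_nhds_in_open)
      ultimately have "eventually (\<lambda>y. False) (inf (nhds l) (filtermap f U))"
        unfolding eventually_inf by blast
      with l show False by (simp add: trivial_limit_def)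
    qed
  qed
  moreover from this have "Lim U f = l"
    using U by (intro tendsto_Lim) (auto simp: ultrafilter_def)
  ultimately show ?thesis by simp
qed

lemma ultrafilter_LimI: "ultrafilter U \<Longrightarrow> (f \<longlongrightarrow> l) U \<Longrightarrow> Lim U f = l"
  by (rule tendsto_Lim) (auto simp: ultrafilter_def)

lemma tendsto_if_all_ultrafilters:
  assumes "\<And>U. ultrafilter U \<Longrightarrow> U \<le> F \<Longrightarrow> (f \<longlongrightarrow> l) U"
  shows "(f \<longlongrightarrow> l) F"
proof (rule topological_tendstoI, rule ccontr)
  fix S assume S: "open S" "l \<in> S" and neg: "\<not> eventually (\<lambda>x. f x \<in> S) F"
  then have "inf F (principal {x. f x \<notin> S}) \<noteq> bot"
    by (simp add: trivial_limit_def eventually_inf_principal)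
  then obtain U where U: "U \<le> inf F (principal {x. f x \<notin> S})" "ultrafilter U"
    by (rule ultrafilter_exists)
  have "eventually (\<lambda>x. f x \<notin> S) U"
    by (rule filter_leD[OF U(1)]) (simp add: eventually_inf_principal)
  moreover have "eventually (\<lambda>x. f x \<in> S) U"
    using topological_tendstoD[OF assms[OF U(2)] S] U(1) by simp
  ultimately have "eventually (\<lambda>x. False) U" by eventually_elim simp
  with U(2) show False by (simp add: ultrafilter_def)
qed

lemma ultrafilter_norm_Lim_le:
  fixes f :: "'a \<Rightarrow> 'b::{heine_borel,real_normed_vector}"
  assumes U: "ultrafilter U" and b: "\<And>x. norm (f x) \<le> C"
  shows "norm (Lim U f) \<le> C"
proof -
  have "(f \<longlongrightarrow> Lim U f) U"
    by (rule ultrafilter_convergent[OF U]) (use b in \<open>auto simp: bounded_iff\<close>)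
  then show ?thesis
    by (rule tendsto_upperbound[OF tendsto_norm])
      (use U b in \<open>auto simp: ultrafilter_def\<close>)
qed

text \<open>
  A filter limit of sequences, taken coordinate by coordinate, is also the limit of an honest
  sequence: only the first \<^term>\<open>s\<close> coordinates are controlled at stage \<^term>\<open>s\<close>. This turns ultrafilter
  limits into sequential ones, which the dominated convergence argument below requires. The side
  condition \<^term>\<open>P s\<close> serves to make the chosen indices tend to infinity.
\<close>

lemma pointwise_limit_sequence:
  fixes g :: "'i \<Rightarrow> nat \<Rightarrow> 'b::metric_space"
  assumes W: "W \<noteq> bot" and lim: "\<And>l. ((\<lambda>i. g i l) \<longlongrightarrow> q l) W"
    and P: "\<And>s. eventually (P s) W"
  obtains i :: "nat \<Rightarrow> 'i" where "\<And>s. P s (i s)" "\<And>l. (\<lambda>s. g (i s) l) \<longlonglongrightarrow> q l"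
proof -
  have "eventually (\<lambda>i. P s i \<and> (\<forall>l\<le>s. dist (g i l) (q l) < inverse (Suc s))) W" for s
  proof (intro eventually_conj P)
    have "eventually (\<lambda>i. \<forall>l\<in>{..s}. dist (g i l) (q l) < inverse (Suc s)) W"
      by (intro eventually_ball_finite ballI tendstoD[OF lim]) simp_all
    then show "eventually (\<lambda>i. \<forall>l\<le>s. dist (g i l) (q l) < inverse (Suc s)) W"
      by (simp add: Ball_def)
  qed
  then have "\<exists>i. P s i \<and> (\<forall>l\<le>s. dist (g i l) (q l) < inverse (Suc s))" for s
    using W eventually_happens' by blast
  then obtain i where i: "\<And>s. P s (i s)"
      "\<And>s l. l \<le> s \<Longrightarrow> dist (g (i s) l) (q l) < inverse (Suc s)"
    by metis
  have "(\<lambda>s. g (i s) l) \<longlonglongrightarrow> q l" for l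
  proof (rule tendstoI)
    fix e :: real assume "0 < e"
    have "eventually (\<lambda>s. inverse (real (Suc s)) < e) sequentially"
      using order_tendstoD(2)[OF LIMSEQ_inverse_real_of_nat \<open>0 < e\<close>] .
    with eventually_ge_at_top[of l]
    show "eventually (\<lambda>s. dist (g (i s) l) (q l) < e) sequentially"
      by eventually_elim (use i(2) in force)
  qed
  with i(1) that show thesis by blast
qed

section \<open>Means along windows\<close>

definition avg :: "nat \<Rightarrow> nat \<Rightarrow> (nat \<Rightarrow> 'a::real_normed_vector) \<Rightarrow> 'a"
  where "avg m N f = (\<Sum>k<N. f (m + k)) /\<^sub>R real N"

lemma avg_add: "avg m N (\<lambda>n. f n + g n) = avg m N f + avg m N g"
  by (simp add: avg_def sum.distrib scaleR_right_distrib)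

lemma avg_diff: "avg m N (\<lambda>n. f n - g n) = avg m N f - avg m N g"
  by (simp add: avg_def sum_subtractf scaleR_right_diff_distrib)

lemma avg_mult_left: "avg m N (\<lambda>n. c * f n) = c * avg m N f" for c :: "'a::real_normed_algebra"
  by (simp add: avg_def sum_distrib_left)

lemma avg_const: "N > 0 \<Longrightarrow> avg m N (\<lambda>n. c) = c"
  by (simp add: avg_def sum_constant_scaleR)

lemma avg_linear: "linear h \<Longrightarrow> avg m N (\<lambda>n. h (f n)) = h (avg m N f)"
  by (simp add: avg_def linear_sum linear_cmul)

lemma avg_mono: "(\<And>n. f n \<le> g n) \<Longrightarrow> avg m N f \<le> avg m N g" for f :: "nat \<Rightarrow> real"
  by (simp add: avg_def sum_mono mult_left_mono)

lemma norm_avg_le_avg: "norm (avg m N f) \<le> avg m N (\<lambda>n. norm (f n))"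
  by (simp add: avg_def mult_left_mono norm_sum)

lemma norm_avg_le:
  assumes "\<And>n. norm (f n) \<le> C"
  shows "norm (avg m N f) \<le> C"
proof (cases "N = 0")
  case True
  have "0 \<le> C" using assms[of 0] norm_ge_zero order_trans by blast
  with True show ?thesis by (simp add: avg_def)
next
  case False
  have "norm (avg m N f) \<le> avg m N (\<lambda>n. C)"
    using norm_avg_le_avg avg_mono[of "\<lambda>n. norm (f n)" "\<lambda>n. C"] assms order_trans by blast
  with False show ?thesis by (simp add: avg_const)
qed

lemma avg_shift_arg: "avg m N (\<lambda>n. f (n + k)) = avg (m + k) N f"
  by (simp add: avg_def add_ac)

lemma norm_avg_shift_le:
  assumes "\<And>n. norm (f n) \<le> C"
  shows "norm (avg m N (\<lambda>n. f (n + k)) - avg m N f) \<le> 2 * k * C / N"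
proof (induction k)
  case (Suc k)
  have "avg m N (\<lambda>n. f (n + Suc k)) - avg m N (\<lambda>n. f (n + k))
      = (f (m + N + k) - f (m + k)) /\<^sub>R N"
  proof -
    have "(\<Sum>j<N. f (m + j + Suc k)) - (\<Sum>j<N. f (m + j + k)) = f (m + N + k) - f (m + k)"
      by (induction N) (auto simp: algebra_simps)
    then show ?thesis
      by (simp add: avg_def flip: scaleR_right_diff_distrib)
  qed
  moreover have "norm (f (m + N + k) - f (m + k)) \<le> 2 * C"
    using norm_triangle_ineq4[of "f (m + N + k)" "f (m + k)"] assms[of "m + N + k"] assms[of "m + k"]
    by linarith
  ultimately have "norm (avg m N (\<lambda>n. f (n + Suc k)) - avg m N (\<lambda>n. f (n + k))) \<le> 2 * C / N"
    by (simp add: divide_simps mult.commute)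
  with Suc have "norm (avg m N (\<lambda>n. f (n + Suc k)) - avg m N f) \<le> 2 * C / N + 2 * k * C / N"
    using norm_triangle_ineq[of "avg m N (\<lambda>n. f (n + Suc k)) - avg m N (\<lambda>n. f (n + k))"
        "avg m N (\<lambda>n. f (n + k)) - avg m N f"] by simp
  also have "\<dots> = 2 * Suc k * C / N" by (simp add: algebra_simps add_divide_distrib)
  finally show ?case by simp
qed simp

lemma bounded_range_iff: "bounded (range f) \<longleftrightarrow> (\<exists>C. \<forall>n. norm (f n) \<le> C)"
  by (auto simp: bounded_iff)

text \<open>
  An ultrafilter limit of averages over longer and longer windows. The resulting functional is
  positive, linear, shift invariant and defined on all bounded sequences, so that the existence of
  a limit never has to be discussed; the freedom to place the windows anywhere yields uniformity.
\<close>

locale window_mean =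
  fixes W :: "'i filter" and m N :: "'i \<Rightarrow> nat"
  assumes ultra: "ultrafilter W" and lengths: "filterlim N at_top W"
begin

definition mean :: "(nat \<Rightarrow> 'b::{heine_borel,real_normed_vector}) \<Rightarrow> 'b"
  where "mean f = Lim W (\<lambda>i. avg (m i) (N i) f)"

lemma not_bot [simp]: "W \<noteq> bot"
  using ultra by (simp add: ultrafilter_def)

lemma mean_eqI: "((\<lambda>i. avg (m i) (N i) f) \<longlongrightarrow> l) W \<Longrightarrow> mean f = l"
  unfolding mean_def by (rule ultrafilter_LimI[OF ultra])

lemma mean_tendsto: "bounded (range f) \<Longrightarrow> ((\<lambda>i. avg (m i) (N i) f) \<longlongrightarrow> mean f) W"
  unfolding mean_def
  by (intro ultrafilter_convergent[OF ultra]) (auto simp: bounded_range_iff intro: norm_avg_le)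

lemma mean_add:
  "bounded (range f) \<Longrightarrow> bounded (range g) \<Longrightarrow> mean (\<lambda>n. f n + g n) = mean f + mean g"
  by (rule mean_eqI) (auto simp: avg_add intro!: tendsto_add mean_tendsto)

lemma mean_diff:
  "bounded (range f) \<Longrightarrow> bounded (range g) \<Longrightarrow> mean (\<lambda>n. f n - g n) = mean f - mean g"
  by (rule mean_eqI) (auto simp: avg_diff intro!: tendsto_diff mean_tendsto)

lemma mean_mult_left: "bounded (range f) \<Longrightarrow> mean (\<lambda>n. c * f n) = c * mean f"
  for f :: "nat \<Rightarrow> 'b::{heine_borel,real_normed_algebra}"
  by (rule mean_eqI) (auto simp: avg_mult_left intro!: tendsto_mult mean_tendsto)

lemma mean_linear:
  fixes h :: "'b::{heine_borel,real_normed_vector} \<Rightarrow> 'c::{heine_borel,real_normed_vector}"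
  assumes "bounded_linear h" "bounded (range f)"
  shows "mean (\<lambda>n. h (f n)) = h (mean f)"
proof (rule mean_eqI)
  show "((\<lambda>i. avg (m i) (N i) (\<lambda>n. h (f n))) \<longlongrightarrow> h (mean f)) W"
    unfolding avg_linear[OF bounded_linear.linear[OF assms(1)]]
    by (rule bounded_linear.tendsto[OF assms(1) mean_tendsto[OF assms(2)]])
qed

lemma mean_const: "mean (\<lambda>n. c) = c"
proof (rule mean_eqI)
  have "eventually (\<lambda>i. N i \<ge> 1) W" using lengths by (simp add: filterlim_at_top)
  then have "eventually (\<lambda>i. avg (m i) (N i) (\<lambda>n. c) = c) W"
    by eventually_elim (simp add: avg_const)
  then show "((\<lambda>i. avg (m i) (N i) (\<lambda>n. c)) \<longlongrightarrow> c) W" by (rule tendsto_eventually)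
qed

lemma mean_sum:
  assumes "\<And>i. i \<in> I \<Longrightarrow> bounded (range (f i))"
  shows "mean (\<lambda>n. \<Sum>i\<in>I. f i n) = (\<Sum>i\<in>I. mean (f i))"
proof (cases "finite I")
  case True
  have "avg a b (\<lambda>n. \<Sum>i\<in>I. f i n) = (\<Sum>i\<in>I. avg a b (f i))" for a b
    using True by (induction I) (simp_all add: avg_add, simp add: avg_def)
  then show ?thesis
    by (intro mean_eqI) (use assms in \<open>auto intro!: tendsto_sum mean_tendsto\<close>)
qed (simp add: mean_const)

lemma mean_mono:
  "bounded (range f) \<Longrightarrow> bounded (range g) \<Longrightarrow> (\<And>n. f n \<le> g n) \<Longrightarrow> mean f \<le> mean g"
  for f :: "nat \<Rightarrow> real"
  by (rule tendsto_le[OF _ mean_tendsto mean_tendsto]) (auto intro!: avg_mono always_eventually)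

lemma norm_mean_le:
  assumes "bounded (range f)"
  shows "norm (mean f) \<le> mean (\<lambda>n. norm (f n))"
  by (rule tendsto_le[OF _ mean_tendsto tendsto_norm[OF mean_tendsto]])
    (use assms in \<open>auto simp: bounded_range_iff norm_avg_le_avg\<close>)

lemma mean_shift:
  assumes "bounded (range f)"
  shows "mean (\<lambda>n. f (n + k)) = mean f"
proof (rule mean_eqI)
  obtain C where C: "\<And>n. norm (f n) \<le> C" using assms by (auto simp: bounded_range_iff)
  have "((\<lambda>i. avg (m i) (N i) (\<lambda>n. f (n + k)) - avg (m i) (N i) f) \<longlongrightarrow> 0) W"
  proof (rule Lim_null_comparison)
    show "((\<lambda>i. 2 * k * C / N i) \<longlongrightarrow> 0) W"
      by (intro tendsto_divide_0[OF tendsto_const] filterlim_at_top_imp_at_infinity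
          filterlim_compose[OF filterlim_real_sequentially lengths])
    show "eventually (\<lambda>i. norm (avg (m i) (N i) (\<lambda>n. f (n + k)) - avg (m i) (N i) f)
        \<le> 2 * k * C / N i) W"
      using norm_avg_shift_le[of f C _ _ k, OF C] by (intro always_eventually) simp
  qed
  then show "((\<lambda>i. avg (m i) (N i) (\<lambda>n. f (n + k))) \<longlongrightarrow> mean f) W"
    using tendsto_add[OF _ mean_tendsto[OF assms]] by fastforce
qed

end

section \<open>Dominated convergence for finitely additive means\<close>

text \<open>
  If all pairwise intersections were small, then about \<open>2 / d\<close> of the sets would have total
  measure at least \<open>2\<close> with little overlap, so their union would have measure greater than \<open>1\<close>.
\<close>

lemma bergelson_step:
  fixes \<mu> :: "'a set \<Rightarrow> real"
  assumes add: "\<And>A B. A \<inter> B = {} \<Longrightarrow> \<mu> (A \<union> B) = \<mu> A + \<mu> B"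
    and nonneg: "\<And>A. 0 \<le> \<mu> A" and le1: "\<And>A. \<mu> A \<le> 1"
    and J: "infinite J" and d: "0 < d" and E: "\<And>j. j \<in> J \<Longrightarrow> d \<le> \<mu> (E j)"
  shows "\<exists>j e. j \<in> J \<and> 0 < e \<and> infinite {i \<in> J. e \<le> \<mu> (E j \<inter> E i)}"
proof (rule ccontr)
  assume contr: "\<not> ?thesis"
  have small: "finite {i \<in> J. e \<le> \<mu> (E j \<inter> E i)}" if "j \<in> J" "0 < e" for j e
    using contr that by blast
  have d1: "d \<le> 1"
  proof -
    obtain j where "j \<in> J" using J by fastforce
    then show ?thesis using E le1 order_trans by blast
  qed
  \<comment> \<open>With \<open>r\<close> sets and \<open>2 \<le> r * d \<le> 3\<close>, the overlaps account for at most \<open>r\<^sup>2 * e \<le> 9 / 16\<close>.\<close>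
  define e where "e = d ^ 2 / 16"
  have e: "0 < e" using d by (simp add: e_def)
  have fin: "finite {i \<in> J. e \<le> \<mu> (E j \<inter> E i)}" if "j \<in> J" for j
    using small that e by blast
  have union: "\<mu> (A \<union> B) = \<mu> A + \<mu> B - \<mu> (A \<inter> B)" for A B
  proof -
    have "A \<union> B = A \<union> (B - A)" "A \<inter> (B - A) = {}"
      "B = (A \<inter> B) \<union> (B - A)" "(A \<inter> B) \<inter> (B - A) = {}" by blast+
    then have "\<mu> (A \<union> B) = \<mu> A + \<mu> (B - A)" "\<mu> B = \<mu> (A \<inter> B) + \<mu> (B - A)"
      using add by metis+
    then show ?thesis by simp
  qed
  \<comment> \<open>Chosen greedily: only finitely many indices have a large intersection with an earlier choice.\<close>
  have "\<exists>S. finite S \<and> S \<subseteq> J \<and> card S = r \<and> \<mu> (\<Union>i\<in>S. E i) \<ge> r * d - r ^ 2 * e" for r :: nat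
  proof -
    have "\<exists>S. finite S \<and> S \<subseteq> J \<and> card S = r \<and> (\<forall>i\<in>S. \<forall>j\<in>S. i \<noteq> j \<longrightarrow> \<mu> (E i \<inter> E j) < e) \<and>
       \<mu> (\<Union>i\<in>S. E i) \<ge> r * d - r ^ 2 * e"
    proof (induction r)
      case 0
      show ?case by (intro exI[of _ "{}"]) (simp add: nonneg)
    next
      case (Suc r)
      then obtain S where S: "finite S" "S \<subseteq> J" "card S = r"
          "\<And>i j. i \<in> S \<Longrightarrow> j \<in> S \<Longrightarrow> i \<noteq> j \<Longrightarrow> \<mu> (E i \<inter> E j) < e"
          "\<mu> (\<Union>i\<in>S. E i) \<ge> r * d - r ^ 2 * e"
        by (elim exE conjE) simp
      have "finite (S \<union> (\<Union>j\<in>S. {i \<in> J. e \<le> \<mu> (E j \<inter> E i)}))"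
        using S fin by (intro finite_UnI finite_UN_I) auto
      then obtain i where i: "i \<in> J" "i \<notin> S" "\<And>j. j \<in> S \<Longrightarrow> \<mu> (E j \<inter> E i) < e"
        using J infinite_super[of J "S \<union> (\<Union>j\<in>S. {i \<in> J. e \<le> \<mu> (E j \<inter> E i)})"] by force
      have sub: "\<mu> (\<Union>j\<in>R. F j) \<le> (\<Sum>j\<in>R. \<mu> (F j))" if "finite R" for R and F :: "'b \<Rightarrow> 'a set"
        using that
      proof (induction R)
        case empty
        then show ?case using add[of "{}" "{}"] by simp
      next
        case (insert x R)
        then show ?case using union[of "F x" "\<Union>j\<in>R. F j"] nonneg[of "F x \<inter> (\<Union>j\<in>R. F j)"] by simp
      qed
      have "\<mu> ((\<Union>j\<in>S. E j) \<inter> E i) = \<mu> (\<Union>j\<in>S. E j \<inter> E i)" by (rule arg_cong[of _ _ \<mu>]) auto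
      also have "\<dots> \<le> (\<Sum>j\<in>S. \<mu> (E j \<inter> E i))" using S by (intro sub) auto
      also have "\<dots> \<le> (\<Sum>j\<in>S. e)" using i by (intro sum_mono) (simp add: less_imp_le)
      finally have "\<mu> ((\<Union>j\<in>S. E j) \<inter> E i) \<le> r * e" using S by simp
      moreover have "\<mu> (\<Union>j\<in>insert i S. E j) = \<mu> (\<Union>j\<in>S. E j) + \<mu> (E i) - \<mu> ((\<Union>j\<in>S. E j) \<inter> E i)"
        using union[of "\<Union>j\<in>S. E j" "E i"] by (simp add: Un_commute)
      moreover have "d \<le> \<mu> (E i)" by (rule E) fact
      ultimately have "\<mu> (\<Union>j\<in>insert i S. E j) \<ge> r * d - r ^ 2 * e + d - r * e"
        using S(5) by linarith
      also have "r * d - r ^ 2 * e + d - r * e = Suc r * d - (real r ^ 2 + r) * e"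
        by (simp add: algebra_simps)
      also have "\<dots> \<ge> Suc r * d - (real (Suc r)) ^ 2 * e"
        using e by (intro diff_left_mono mult_right_mono) (auto simp: power2_eq_square algebra_simps)
      finally have "\<mu> (\<Union>j\<in>insert i S. E j) \<ge> Suc r * d - (real (Suc r)) ^ 2 * e" .
      with i S show ?case
        by (intro exI[of _ "insert i S"]) (auto simp: Int_commute)
    qed
    then show ?thesis by blast
  qed
  from this[of "nat \<lceil>2 / d\<rceil>"] have le: "nat \<lceil>2 / d\<rceil> * d - (nat \<lceil>2 / d\<rceil>) ^ 2 * e \<le> 1"
    using le1 order_trans by blast
  define r :: real where "r = nat \<lceil>2 / d\<rceil>"
  have "r = \<lceil>2 / d\<rceil>" using d by (simp add: r_def)
  then have "r \<ge> 2 / d" "r \<le> 2 / d + 1" by linarith+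
  then have "2 \<le> r * d" "r * d \<le> 2 + d" using d by (auto simp: field_simps)
  then have "2 \<le> r * d" "r * d \<le> 3" using d1 by auto
  moreover have "r ^ 2 * e = (r * d) ^ 2 / 16" by (simp add: e_def power_mult_distrib)
  moreover have "(r * d) ^ 2 \<le> 3 ^ 2" using calculation by (intro power_mono) auto
  ultimately show False using le by (auto simp: r_def)
qed

text \<open>
  Bergelson's intersectivity lemma: sets of measure bounded below have an infinite subfamily with
  nonempty finite intersections. The previous lemma is iterated, each time with the intersection of
  the sets chosen so far as ambient set; the lower bound \<open>d\<close> may shrink, but stays positive.
\<close>

lemma bergelson:
  fixes \<mu> :: "'a set \<Rightarrow> real" and E :: "nat \<Rightarrow> 'a set"
  assumes add: "\<And>A B. A \<inter> B = {} \<Longrightarrow> \<mu> (A \<union> B) = \<mu> A + \<mu> B"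
    and nonneg: "\<And>A. 0 \<le> \<mu> A" and le1: "\<And>A. \<mu> A \<le> 1"
    and J: "infinite J" and d: "0 < d" and E: "\<And>j. j \<in> J \<Longrightarrow> d \<le> \<mu> (E j)"
  shows "\<exists>(j :: nat \<Rightarrow> nat) x. strict_mono j \<and> (\<forall>s t. s < t \<longrightarrow> x t \<in> E (j s))"
proof -
  \<comment> \<open>A state consists of the current intersection \<open>A\<close>, the infinite set \<open>I\<close> of remaining candidates, the
    lower bound \<open>d\<close>, and a bound \<open>k\<close> below all candidates that makes the selection increasing.\<close>
  define P where "P = (\<lambda>(n::nat) (A, I, d::real, k::nat). infinite I \<and> 0 < d \<and> (\<forall>i\<in>I. d \<le> \<mu> (A \<inter> E i) \<and> k \<le> i))"
  define Q where "Q = (\<lambda>(n::nat) (A, I, d::real, k::nat) (A', I'::nat set, d'::real, k').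
    \<exists>i\<in>I. A' = A \<inter> E i \<and> k' = Suc i)"
  have "\<exists>f. \<forall>n. P n (f n) \<and> Q n (f n) (f (Suc n))"
  proof (rule dependent_nat_choice)
    show "\<exists>x. P 0 x"
      by (rule exI[of _ "(UNIV, J, d, 0)"]) (use J d E in \<open>auto simp: P_def\<close>)
  next
    fix x n assume "P n x"
    then obtain A I d k where x: "x = (A, I, d, k)" "infinite I" "0 < d"
        "\<And>i. i \<in> I \<Longrightarrow> d \<le> \<mu> (A \<inter> E i)"
      by (cases x) (auto simp: P_def)
    obtain i e where i: "i \<in> I" "0 < e" "infinite {l \<in> I. e \<le> \<mu> ((A \<inter> E i) \<inter> (A \<inter> E l))}"
      using bergelson_step[of \<mu> I d "\<lambda>l. A \<inter> E l"] add nonneg le1 x by auto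
    define I' where "I' = {l \<in> I. e \<le> \<mu> ((A \<inter> E i) \<inter> (A \<inter> E l))} - {..i}"
    have "infinite I'" using i(3) by (simp add: I'_def)
    moreover have "(A \<inter> E i) \<inter> (A \<inter> E l) = (A \<inter> E i) \<inter> E l" for l by auto
    ultimately have "P (Suc n) (A \<inter> E i, I', e, Suc i)"
      using i by (auto simp: P_def I'_def)
    with i x show "\<exists>y. P (Suc n) y \<and> Q n x y"
      by (intro exI[of _ "(A \<inter> E i, I', e, Suc i)"]) (auto simp: Q_def)
  qed
  then obtain f where f: "\<And>n. P n (f n)" "\<And>n. Q n (f n) (f (Suc n))" by blast
  define A I k where "A n = fst (f n)" and "I n = fst (snd (f n))" and "k n = snd (snd (snd (f n)))" for n
  have "\<exists>i\<in>I n. A (Suc n) = A n \<inter> E i \<and> k (Suc n) = Suc i" for n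
    using f(2)[of n] by (simp add: Q_def A_def I_def k_def split: prod.splits)
  then obtain j where j: "\<And>n. j n \<in> I n" "\<And>n. A (Suc n) = A n \<inter> E (j n)" "\<And>n. k (Suc n) = Suc (j n)"
    by metis
  have kI: "k n \<le> i" if "i \<in> I n" for n i
    using f(1)[of n] that by (auto simp: P_def I_def k_def split: prod.splits)
  have "strict_mono j"
  proof (rule strict_monoI_Suc)
    fix n show "j n < j (Suc n)" using kI[OF j(1)[of "Suc n"]] j(3)[of n] by simp
  qed
  have "A n \<noteq> {}" for n
  proof -
    have "infinite (fst (snd (f n)))" "0 < fst (snd (snd (f n)))"
        "\<forall>i\<in>fst (snd (f n)). fst (snd (snd (f n))) \<le> \<mu> (fst (f n) \<inter> E i)"
      using f(1)[of n] by (auto simp: P_def split: prod.splits)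
    then obtain i where "0 < \<mu> (A n \<inter> E i)"
      unfolding A_def by (metis finite.emptyI ex_in_conv less_le_trans)
    moreover have "\<mu> {} = 0" using add[of "{}" "{}"] by simp
    ultimately show ?thesis by auto
  qed
  then have "\<forall>n. \<exists>x. x \<in> A n" by auto
  then obtain x where x: "\<And>n. x n \<in> A n" by metis
  have "A t \<subseteq> E (j s)" if "s < t" for s t
    using that by (induction t) (auto simp: j(2) less_Suc_eq)
  then have "x t \<in> E (j s)" if "s < t" for s t using x[of t] that by auto
  with \<open>strict_mono j\<close> show ?thesis by (intro exI[of _ j] exI[of _ x]) simp
qed

context window_mean begin

text \<open>
  This replaces the dominated convergence theorem, which fails for finitely additive measures when
  convergence is only required at the points of \<open>\<nat>\<close>. Requiring it at every ultrafilter, that is on the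
  Stone-Cech compactification, repairs this: if the means stay large, then so do the measures of the
  sets \<open>{n. d \<le> q j n}\<close>, and Bergelson's lemma provides an ultrafilter that contains infinitely many of
  them, hence a point at which \<^term>\<open>q\<close> does not tend to zero.
\<close>

lemma mean_tendsto_zero:
  fixes q :: "nat \<Rightarrow> nat \<Rightarrow> real"
  assumes q: "\<And>j n. 0 \<le> q j n" "\<And>j n. q j n \<le> C"
    and lim: "\<And>V. ultrafilter V \<Longrightarrow> (\<lambda>j. Lim V (q j)) \<longlonglongrightarrow> 0"
  shows "(\<lambda>j. mean (q j)) \<longlonglongrightarrow> 0"
proof (rule ccontr)
  have bq: "bounded (range (q j))" for j using q unfolding bounded_range_iff by (auto intro!: exI[of _ C])
  assume "\<not> ?thesis"
  then obtain e where "e > 0" and freq: "\<not> eventually (\<lambda>j. dist (mean (q j)) 0 < e) sequentially"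
    unfolding tendsto_iff by blast
  define d where "d = e / 2"
  have d: "0 < d" using \<open>e > 0\<close> by (simp add: d_def)
  have "0 \<le> mean (q j)" for j
    using mean_mono[of "\<lambda>_. 0" "q j"] q bq by (simp add: mean_const bounded_range_iff)
  with freq have freq: "\<not> eventually (\<lambda>j. mean (q j) < 2 * d) sequentially"
    by (simp add: dist_norm d_def)
  define J where "J = {j. 2 * d \<le> mean (q j)}"
  have J: "infinite J"
  proof
    assume "finite J"
    then obtain k where k: "\<And>j. j \<in> J \<Longrightarrow> j < k" using finite_nat_set_iff_bounded by auto
    have "mean (q j) < 2 * d" if "k \<le> j" for j
      using k[of j] that by (cases "j \<in> J") (simp_all add: J_def)
    then have "eventually (\<lambda>j. mean (q j) < 2 * d) sequentially"
      by (rule eventually_sequentiallyI)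
    with freq show False by blast
  qed
  define \<mu> :: "nat set \<Rightarrow> real" where "\<mu> A = mean (indicat_real A)" for A
  have bi: "bounded (range (indicat_real A))" for A :: "nat set"
    unfolding bounded_range_iff by (intro exI[of _ 1]) (simp add: indicator_def)
  have add: "\<mu> (A \<union> B) = \<mu> A + \<mu> B" if "A \<inter> B = {}" for A B
    unfolding \<mu>_def by (subst mean_add[symmetric, OF bi bi]) (use that in \<open>auto intro!: arg_cong[of _ _ mean] simp: indicator_def fun_eq_iff\<close>)
  have nonneg: "0 \<le> \<mu> A" for A
    using mean_mono[of "\<lambda>_. 0" "indicat_real A"] bi by (simp add: \<mu>_def mean_const bounded_range_iff)
  have le1: "\<mu> A \<le> 1" for A
    using mean_mono[of "indicat_real A" "\<lambda>_. 1"] bi by (simp add: \<mu>_def mean_const bounded_range_iff indicator_def)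
  define E where "E j = {n. d \<le> q j n}" for j
  define C' where "C' = max C 1"
  have C': "0 < C'" by (simp add: C'_def)
  have E: "d / C' \<le> \<mu> (E j)" if "j \<in> J" for j
  proof -
    have "2 * d \<le> mean (q j)" using that by (simp add: J_def)
    also have "\<dots> \<le> mean (\<lambda>n. d + C' * indicat_real (E j) n)"
    proof (rule mean_mono[OF bq])
      show "bounded (range (\<lambda>n. d + C' * indicat_real (E j) n))"
        unfolding bounded_range_iff using d C' by (intro exI[of _ "d + C'"]) (auto simp: indicator_def)
      show "q j n \<le> d + C' * indicat_real (E j) n" for n
        using q(2)[of j n] d by (auto simp: E_def indicator_def C'_def)
    qed
    also have "\<dots> = d + C' * \<mu> (E j)"
    proof -
      have "bounded (range (\<lambda>n. C' * indicat_real (E j) n))"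
        unfolding bounded_range_iff using C' by (intro exI[of _ C']) (auto simp: indicator_def)
      then show ?thesis
        by (subst mean_add) (use bi in \<open>auto simp: \<mu>_def mean_const mean_mult_left bounded_range_iff\<close>)
    qed
    finally show ?thesis using C' by (simp add: field_simps)
  qed
  have "\<exists>(j :: nat \<Rightarrow> nat) x. strict_mono j \<and> (\<forall>s t. s < t \<longrightarrow> x t \<in> E (j s))"
    by (rule bergelson[of \<mu> J "d / C'" E])
      (simp_all add: add nonneg le1 J E divide_pos_pos[OF d C'])
  then obtain j :: "nat \<Rightarrow> nat" and x
    where "strict_mono j \<and> (\<forall>s t. s < t \<longrightarrow> x t \<in> E (j s))" by (elim exE)
  then have jx: "strict_mono j" "\<And>s t. s < t \<Longrightarrow> x t \<in> E (j s)" by simp_all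
  obtain V0 where V0: "V0 \<le> sequentially" "ultrafilter V0"
    using ultrafilter_exists[of sequentially] by auto
  define V where "V = filtermap x V0"
  have V: "ultrafilter V" unfolding V_def by (rule ultrafilter_filtermap[OF V0(2)])
  have "d \<le> Lim V (q (j s))" for s
  proof (rule tendsto_lowerbound[OF ultrafilter_convergent[OF V bq]])
    have "eventually (\<lambda>t. s < t) V0" using V0(1) eventually_gt_at_top filter_leD by blast
    then show "eventually (\<lambda>n. d \<le> q (j s) n) V"
      unfolding V_def eventually_filtermap by eventually_elim (use jx(2) in \<open>auto simp: E_def\<close>)
  qed (use V in \<open>simp add: ultrafilter_def\<close>)
  moreover have "(\<lambda>s. Lim V (q (j s))) \<longlonglongrightarrow> 0"
    using LIMSEQ_subseq_LIMSEQ[OF lim[OF V] jx(1)] by (simp add: o_def)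
  ultimately have "d \<le> 0" by (intro LIMSEQ_le_const) auto
  with d show False by simp
qed

end

section \<open>Weakly almost periodic sequences and their uniform means\<close>

text \<open>
  Weak almost periodicity in the form of Grothendieck's iterated limit criterion. For bounded
  sequences it is equivalent to relative weak compactness of the set of shifts in \<open>\<ell>\<^sup>\<infinity>\<close>.
\<close>

definition wap :: "(nat \<Rightarrow> complex) \<Rightarrow> bool"
  where "wap a \<longleftrightarrow> bounded (range a) \<and>
    (\<forall>U V. ultrafilter U \<longrightarrow> ultrafilter V \<longrightarrow>
      Lim U (\<lambda>k. Lim V (\<lambda>n. a (k + n))) = Lim V (\<lambda>n. Lim U (\<lambda>k. a (k + n))))"

lemma Lim_filtermap: "Lim (filtermap h F) f = Lim F (\<lambda>x. f (h x))"
  for f :: "'a \<Rightarrow> 'b::t2_space"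
  by (simp add: t2_space_class.Lim_def filterlim_def filtermap_filtermap)

text \<open>
  The iterated limit criterion says exactly that pointwise convergence of shifts
  extends to the ultrafilters, which is the hypothesis of the dominated convergence lemma above.
\<close>

lemma wap_pointwise_limit:
  assumes a: "wap a" and lim: "\<And>l. (\<lambda>s. a (k s + l)) \<longlonglongrightarrow> q l" and V: "ultrafilter V"
  shows "(\<lambda>s. Lim V (\<lambda>l. cmod (a (k s + l) - q l))) \<longlonglongrightarrow> 0"
proof -
  obtain C where C: "\<And>n. cmod (a n) \<le> C" using a by (auto simp: wap_def bounded_range_iff)
  have qC: "cmod (q l) \<le> C" for l
    by (rule tendsto_upperbound[OF tendsto_norm[OF lim]]) (use C in auto)
  define r where "r s = Lim V (\<lambda>l. a (k s + l))" for s
  have rC: "bounded (range r)"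
    unfolding bounded_range_iff r_def by (intro exI[of _ C] allI ultrafilter_norm_Lim_le V C)
  have "r \<longlonglongrightarrow> Lim V q"
  proof (rule tendsto_if_all_ultrafilters)
    fix W :: "nat filter" assume W: "ultrafilter W" "W \<le> sequentially"
    have "Lim W r = Lim (filtermap k W) (\<lambda>k. Lim V (\<lambda>n. a (k + n)))"
      by (simp add: Lim_filtermap r_def[abs_def])
    also have "\<dots> = Lim V (\<lambda>n. Lim (filtermap k W) (\<lambda>k. a (k + n)))"
      using a ultrafilter_filtermap[OF W(1), of k] V by (simp add: wap_def)
    also have "(\<lambda>n. Lim (filtermap k W) (\<lambda>k. a (k + n))) = q"
      by (rule ext, subst Lim_filtermap, rule ultrafilter_LimI[OF W(1)])
        (rule filterlim_mono[OF lim order_refl W(2)])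
    finally show "(r \<longlongrightarrow> Lim V q) W" using ultrafilter_convergent[OF W(1) rC] by simp
  qed
  then have "(\<lambda>s. cmod (r s - Lim V q)) \<longlonglongrightarrow> 0"
    using LIM_zero tendsto_norm_zero by blast
  moreover have "Lim V (\<lambda>l. cmod (a (k s + l) - q l)) = cmod (r s - Lim V q)" for s
    unfolding r_def
    by (intro ultrafilter_LimI[OF V] tendsto_norm tendsto_diff ultrafilter_convergent[OF V])
      (use C qC in \<open>auto simp: bounded_range_iff\<close>)
  ultimately show ?thesis by simp
qed

context window_mean begin

lemma mean_orbit_limit:
  assumes a: "wap a" and lim: "\<And>l. (\<lambda>s. a (k s + l)) \<longlonglongrightarrow> q l"
  shows "(\<lambda>s. mean (\<lambda>l. cmod (a (k s + l) - q l))) \<longlonglongrightarrow> 0"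
proof -
  obtain C where C: "\<And>n. cmod (a n) \<le> C" using a by (auto simp: wap_def bounded_range_iff)
  have qC: "cmod (q l) \<le> C" for l
    by (rule tendsto_upperbound[OF tendsto_norm[OF lim]]) (use C in auto)
  show ?thesis
  proof (rule mean_tendsto_zero[where C = "2 * C"])
    show "cmod (a (k s + l) - q l) \<le> 2 * C" for s l
      using norm_triangle_ineq4[of "a (k s + l)" "q l"] C[of "k s + l"] qC[of l] by linarith
  qed (use wap_pointwise_limit[OF a lim] in auto)
qed

lemma mean_ultrafilter_shift:
  assumes a: "wap a" and V: "ultrafilter V"
  shows "mean (\<lambda>l. Lim V (\<lambda>k. a (k + l))) = mean a"
proof -
  obtain C where C: "\<And>n. cmod (a n) \<le> C" using a by (auto simp: wap_def bounded_range_iff)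
  define q where "q l = Lim V (\<lambda>k. a (k + l))" for l
  have qC: "cmod (q l) \<le> C" for l
    unfolding q_def by (intro ultrafilter_norm_Lim_le V C)
  have "((\<lambda>k. a (k + l)) \<longlongrightarrow> q l) V" for l
    unfolding q_def by (rule ultrafilter_convergent[OF V]) (use C in \<open>auto simp: bounded_range_iff\<close>)
  then obtain k :: "nat \<Rightarrow> nat" where k: "\<And>l. (\<lambda>s. a (k s + l)) \<longlonglongrightarrow> q l"
    using pointwise_limit_sequence[where g = "\<lambda>k l. a (k + l)" and P = "\<lambda>_ _. True" and q = q and W = V]
      ultrafilter_not_bot[OF V] by auto
  have ba: "bounded (range (\<lambda>l. a (j + l)))" "bounded (range q)" for j
    using C qC by (auto simp: bounded_range_iff)
  have "cmod (mean a - mean q) \<le> mean (\<lambda>l. cmod (a (k s + l) - q l))" for s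
  proof -
    have "mean a = mean (\<lambda>l. a (k s + l))"
      using mean_shift[of a "k s"] a by (simp add: wap_def add.commute)
    then have "mean a - mean q = mean (\<lambda>l. a (k s + l) - q l)"
      by (simp add: mean_diff ba)
    then show ?thesis using norm_mean_le[OF bounded_minus_comp[OF ba(1) ba(2)]] by simp
  qed
  then have "cmod (mean a - mean q) \<le> 0"
    by (intro LIMSEQ_le_const[OF mean_orbit_limit[OF a k]]) auto
  then show ?thesis by (simp add: q_def[abs_def])
qed

text \<open>
  Two windows produce the same mean, by a Fubini argument. Averaging \<open>a (k + l)\<close> over the primed
  windows in \<open>l\<close> gives functions of \<open>k\<close> that converge to \<open>\<beta>\<close> at every ultrafilter, since a
  shift of \<open>a\<close> by an ultrafilter has the same mean as \<open>a\<close>. By dominated convergence their means in \<open>k\<close>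
  converge to \<open>\<beta>\<close> as well; but all these means equal the mean of \<open>a\<close> by shift invariance.
\<close>

lemma mean_unique:
  assumes a: "wap a" and N': "filterlim N' at_top sequentially"
    and lim: "(\<lambda>j. avg (m' j) (N' j) a) \<longlonglongrightarrow> \<beta>"
  shows "mean a = \<beta>"
proof -
  obtain C where C: "\<And>n. cmod (a n) \<le> C" using a by (auto simp: wap_def bounded_range_iff)
  define h where "h j k = avg (m' j) (N' j) (\<lambda>l. a (k + l))" for j k
  have hC: "cmod (h j k) \<le> C" for j k
    unfolding h_def by (intro norm_avg_le C)
  define q where "q j k = cmod (h j k - \<beta>)" for j k
  have "(\<lambda>j. Lim V (q j)) \<longlonglongrightarrow> 0" if V: "ultrafilter V" for V
  proof -
    define b where "b l = Lim V (\<lambda>k. a (k + l))" for l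
    have conv: "((\<lambda>k. a (k + l)) \<longlongrightarrow> b l) V" for l
      unfolding b_def by (rule ultrafilter_convergent[OF V]) (use C in \<open>auto simp: bounded_range_iff\<close>)
    have bC: "bounded (range b)"
      unfolding bounded_range_iff b_def by (intro exI[of _ C] allI ultrafilter_norm_Lim_le V C)
    have "(\<lambda>j. avg (m' j) (N' j) b) \<longlonglongrightarrow> \<beta>"
    proof (rule tendsto_if_all_ultrafilters)
      fix W' :: "nat filter" assume W': "ultrafilter W'" "W' \<le> sequentially"
      interpret M': window_mean W' m' N'
        by unfold_locales (use W' filterlim_mono[OF N' order_refl W'(2)] in auto)
      have "M'.mean b = M'.mean a" unfolding b_def[abs_def] by (rule M'.mean_ultrafilter_shift[OF a V])
      also have "\<dots> = \<beta>" by (rule M'.mean_eqI) (rule filterlim_mono[OF lim order_refl W'(2)])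
      finally show "((\<lambda>j. avg (m' j) (N' j) b) \<longlongrightarrow> \<beta>) W'"
        using M'.mean_tendsto[OF bC] by simp
    qed
    then have "(\<lambda>j. cmod (avg (m' j) (N' j) b - \<beta>)) \<longlonglongrightarrow> 0"
      using LIM_zero tendsto_norm_zero by blast
    moreover have "Lim V (q j) = cmod (avg (m' j) (N' j) b - \<beta>)" for j
      unfolding q_def h_def avg_def
      by (intro ultrafilter_LimI[OF V] tendsto_intros conv)
    ultimately show ?thesis by simp
  qed
  then have "(\<lambda>j. mean (q j)) \<longlonglongrightarrow> 0"
  proof (intro mean_tendsto_zero[where C = "C + cmod \<beta>"])
    show "q j k \<le> C + cmod \<beta>" for j k
      using norm_triangle_ineq4[of "h j k" \<beta>] hC[of j k] by (simp add: q_def)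
  qed (auto simp: q_def)
  moreover have "eventually (\<lambda>j. cmod (mean a - \<beta>) \<le> mean (q j)) sequentially"
  proof -
    have "eventually (\<lambda>j. N' j \<ge> 1) sequentially" using N' by (simp add: filterlim_at_top)
    then show ?thesis
    proof eventually_elim
      case (elim j)
      have bs: "bounded (range (\<lambda>k. a (k + (m' j + l))))" for l
        using C by (auto simp: bounded_range_iff)
      have bh: "bounded (range (h j))" using hC by (auto simp: bounded_range_iff)
      have bS: "bounded (range (\<lambda>k. \<Sum>l<N' j. a (k + (m' j + l))))"
        using sum_norm_bound[of "{..<N' j}" "\<lambda>l. a (_ + (m' j + l))" C] C
        by (auto simp: bounded_range_iff)
      have "mean (h j) = mean (\<lambda>k. \<Sum>l<N' j. a (k + (m' j + l))) /\<^sub>R N' j"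
        unfolding h_def avg_def by (rule mean_linear[OF bounded_linear_scaleR_right bS])
      also have "mean (\<lambda>k. \<Sum>l<N' j. a (k + (m' j + l))) = (\<Sum>l<N' j. mean a)"
        using a by (subst mean_sum[OF bs]) (simp add: mean_shift wap_def)
      finally have "mean (h j) = mean a" using elim by (simp add: scaleR_conv_of_real)
      then have "mean a - \<beta> = mean (\<lambda>k. h j k - \<beta>)"
        using bh by (simp add: mean_diff mean_const)
      then show ?case
        using norm_mean_le[OF bounded_minus_comp[OF bh, of "\<lambda>_. \<beta>"]] by (simp add: q_def[abs_def])
    qed
  qed
  ultimately have "cmod (mean a - \<beta>) \<le> 0"
    using tendsto_lowerbound by fastforce
  then show ?thesis by simp
qed

end

text \<open>
  The mean ergodic theorem for the shift. If the averages were not uniformly convergent, then badly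
  placed windows would define a second mean with a different value.
\<close>

theorem wap_uniform_mean:
  assumes a: "wap a"
  obtains \<beta> where "uniform_limit UNIV (\<lambda>N m. avg m N a) (\<lambda>_. \<beta>) sequentially"
proof -
  obtain C where C: "\<And>n. cmod (a n) \<le> C" using a by (auto simp: wap_def bounded_range_iff)
  have "bounded (range (\<lambda>N. avg 0 N a))"
    unfolding bounded_range_iff by (intro exI[of _ C] allI norm_avg_le C)
  then obtain \<beta> r where r: "strict_mono r" "((\<lambda>N. avg 0 N a) \<circ> r) \<longlonglongrightarrow> \<beta>"
    using bounded_imp_convergent_subsequence by blast
  have "uniform_limit UNIV (\<lambda>N m. avg m N a) (\<lambda>_. \<beta>) sequentially"
  proof (rule ccontr)
    assume "\<not> ?thesis"
    then obtain e where e: "e > 0"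
      and freq: "\<not> eventually (\<lambda>N. \<forall>m\<in>UNIV. dist (avg m N a) \<beta> < e) sequentially"
      unfolding uniform_limit_iff by blast
    have "\<forall>j. \<exists>p. fst p \<ge> j \<and> dist (avg (snd p) (fst p) a) \<beta> \<ge> e"
    proof
      fix j
      obtain N where "N \<ge> j" "\<not> (\<forall>m\<in>UNIV. dist (avg m N a) \<beta> < e)"
        using freq unfolding eventually_sequentially by blast
      then obtain m where "dist (avg m N a) \<beta> \<ge> e" by (auto simp: not_less)
      with \<open>N \<ge> j\<close> show "\<exists>p. fst p \<ge> j \<and> dist (avg (snd p) (fst p) a) \<beta> \<ge> e"
        by (intro exI[of _ "(N, m)"]) simp
    qed
    then obtain p where p: "\<And>j. fst (p j) \<ge> j \<and> dist (avg (snd (p j)) (fst (p j)) a) \<beta> \<ge> e"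
      unfolding choice_iff by auto
    define N m where "N = fst \<circ> p" and "m = snd \<circ> p"
    have N: "\<And>j. N j \<ge> j" and far: "\<And>j. dist (avg (m j) (N j) a) \<beta> \<ge> e"
      using p by (simp_all add: N_def m_def)
    obtain W where W: "W \<le> sequentially" "ultrafilter W"
      using ultrafilter_exists[of sequentially] by auto
    have "filterlim N at_top sequentially"
      using N by (intro filterlim_at_top_mono[OF filterlim_ident]) auto
    then interpret window_mean W m N
      by unfold_locales (use W filterlim_mono[OF _ order_refl W(1)] in auto)
    have "mean a = \<beta>"
      by (rule mean_unique[OF a filterlim_subseq[OF r(1)], of "\<lambda>_. 0"])
        (use r(2) in \<open>simp add: o_def\<close>)
    then have "((\<lambda>j. avg (m j) (N j) a) \<longlongrightarrow> \<beta>) W"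
      using mean_tendsto a by (auto simp: wap_def)
    then have "eventually (\<lambda>j. dist (avg (m j) (N j) a) \<beta> < e) W" using e by (rule tendstoD)
    then obtain j where "dist (avg (m j) (N j) a) \<beta> < e"
      using eventually_happens'[OF not_bot] by auto
    with far[of j] show False by simp
  qed
  with that show thesis by blast
qed

section \<open>Wiener's lemma\<close>

lemma sum_roots_of_unity:
  fixes d :: int
  assumes R: "0 < R" and d: "\<not> int R dvd d"
  shows "(\<Sum>r<R. cis (2 * pi * of_int d / R) ^ r) = 0"
proof -
  have "cis (2 * pi * of_int d / R) \<noteq> 1"
  proof
    assume "cis (2 * pi * of_int d / R) = 1"
    then have "cos (2 * pi * of_int d / R) = 1" by (metis cis.sel(1) one_complex.sel(1))
    then obtain n :: int where "2 * pi * of_int d / R = of_int n * 2 * pi"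
      using cos_one_2pi_int by auto
    then have "real_of_int d = of_int (n * int R)" using R by (simp add: field_simps)
    then have "d = n * int R" by linarith
    with d show False by simp
  qed
  moreover have "cis (2 * pi * of_int d / R) ^ R = 1"
  proof -
    have "cis (2 * pi * of_int d / R) ^ R = cis (2 * pi * of_int d)"
      using R by (simp add: Complex.DeMoivre)
    also have "\<dots> = 1" by (simp add: complex_eq_iff cos_int_2pin sin_int_2pin)
    finally show ?thesis .
  qed
  ultimately show ?thesis by (simp add: sum_gp_strict)
qed

lemma sum_cis_pairs:
  fixes R k l :: nat
  assumes R: "0 < R" and k: "k < R" and l: "l < R"
  shows "(\<Sum>r<R. cnj (cis (2 * pi * real r / real R)) ^ k * cis (2 * pi * real r / real R) ^ l)
       = (if k = l then of_nat R else 0)"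
proof -
  have "cnj (cis (2 * pi * real r / real R)) ^ k * cis (2 * pi * real r / real R) ^ l
      = cis (2 * pi * of_int (int l - int k) / R) ^ r" for r :: nat
    by (simp add: cis_cnj Complex.DeMoivre cis_mult) (rule arg_cong[of _ _ cis], use R in \<open>simp add: field_simps\<close>)
  then have "(\<Sum>r<R. cnj (cis (2 * pi * real r / real R)) ^ k * cis (2 * pi * real r / real R) ^ l)
      = (\<Sum>r<R. cis (2 * pi * of_int (int l - int k) / R) ^ r)" by simp
  also have "\<dots> = (if k = l then of_nat R else 0)"
  proof (cases "k = l")
    case False
    have "\<not> int R dvd int l - int k"
      using False k l zdvd_not_zless[of "\<bar>int l - int k\<bar>" "int R"] by auto
    with False show ?thesis using sum_roots_of_unity[OF R, of "int l - int k"] by simp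
  qed simp
  finally show ?thesis .
qed

lemma finite_parseval:
  fixes g :: "nat \<Rightarrow> complex"
  assumes R: "0 < R"
  shows "(\<Sum>r<R. (cmod (\<Sum>m<R. cnj (cis (2 * pi * real r / real R)) ^ m * g m))\<^sup>2) = R * (\<Sum>m<R. (cmod (g m))\<^sup>2)"
proof -
  define w where "w r = cis (2 * pi * real r / R)" for r
  have "complex_of_real (\<Sum>r<R. (cmod (\<Sum>m<R. cnj (w r) ^ m * g m))\<^sup>2)
      = (\<Sum>r<R. (\<Sum>m<R. cnj (w r) ^ m * g m) * (\<Sum>l<R. w r ^ l * cnj (g l)))"
    by (simp add: complex_norm_square del: of_real_power)
  also have "\<dots> = (\<Sum>r<R. \<Sum>m<R. \<Sum>l<R. g m * cnj (g l) * (cnj (w r) ^ m * w r ^ l))"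
    unfolding sum_product by (intro sum.cong refl) (simp add: mult_ac)
  also have "\<dots> = (\<Sum>m<R. \<Sum>l<R. \<Sum>r<R. g m * cnj (g l) * (cnj (w r) ^ m * w r ^ l))"
    by (rule trans[OF sum.swap], rule sum.cong[OF refl], rule sum.swap)
  also have "\<dots> = (\<Sum>m<R. \<Sum>l<R. g m * cnj (g l) * (if m = l then of_nat R else 0))"
    unfolding sum_distrib_left[symmetric] w_def
    by (intro sum.cong refl arg_cong2[of _ _ _ _ "(*)"] sum_cis_pairs[OF R]) auto
  also have "\<dots> = complex_of_real (R * (\<Sum>m<R. (cmod (g m))\<^sup>2))"
    by (simp add: complex_norm_square sum_distrib_left mult_ac if_distrib sum.delta cong: if_cong del: of_real_power)
  finally show ?thesis unfolding w_def of_real_eq_iff .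
qed

context window_mean begin

text \<open>
  The mean turns sequences into a semi-inner product space on which the shift is isometric. There,
  \<open>corr k l\<close> is the inner product of the \<open>k\<close>-th and the \<open>l\<close>-th shift of \<open>f\<close>, and \<open>energy z L\<close> is the squared
  norm of the sum of the first \<open>L\<close> shifts twisted by the powers of the conjugate of \<open>z\<close>.
\<close>

context
  fixes f :: "nat \<Rightarrow> complex"
  assumes f: "wap f"
begin

definition corr :: "nat \<Rightarrow> nat \<Rightarrow> complex"
  where "corr k l = mean (\<lambda>n. f (n + k) * cnj (f (n + l)))"

definition energy :: "complex \<Rightarrow> nat \<Rightarrow> real"
  where "energy z L = mean (\<lambda>n. (cmod (\<Sum>k<L. cnj z ^ k * f (n + k)))\<^sup>2)"

lemma bounded_f: "\<exists>C>0. \<forall>n. cmod (f n) \<le> C"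
proof -
  obtain C where C: "\<And>n. cmod (f n) \<le> C" using f by (auto simp: wap_def bounded_range_iff)
  show ?thesis by (rule exI[of _ "max C 1"]) (use C in \<open>auto simp: max.coboundedI1\<close>)
qed

lemma bounded_products: "bounded (range (\<lambda>n. f (n + k) * cnj (f (n + l))))"
proof -
  obtain C where C: "C > 0" "\<And>n. cmod (f n) \<le> C" using bounded_f by auto
  show ?thesis unfolding bounded_range_iff
    using C by (intro exI[of _ "C * C"]) (auto simp: norm_mult intro!: mult_mono)
qed

lemma bounded_partial_sums: "bounded (range (\<lambda>n. (cmod (\<Sum>k<L. cnj z ^ k * f (n + k)))\<^sup>2))"
proof -
  obtain C where C: "C > 0" "\<And>n. cmod (f n) \<le> C" using bounded_f by auto
  have "cmod (\<Sum>k<L. cnj z ^ k * f (n + k)) \<le> (\<Sum>k<L. cmod z ^ k * C)" for n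
    using C by (intro sum_norm_le) (auto simp: norm_mult norm_power intro!: mult_left_mono)
  then have "(cmod (\<Sum>k<L. cnj z ^ k * f (n + k)))\<^sup>2 \<le> (\<Sum>k<L. cmod z ^ k * C)\<^sup>2" for n
    by (intro power_mono) auto
  then show ?thesis unfolding bounded_range_iff
    by (intro exI[of _ "(\<Sum>k<L. cmod z ^ k * C)\<^sup>2"]) simp
qed

lemma energy_nonneg: "0 \<le> energy z L"
  unfolding energy_def
  using mean_mono[OF _ bounded_partial_sums, of "\<lambda>_. 0"] by (simp add: mean_const bounded_range_iff)

lemma corr_shift: "corr (k + j) (l + j) = corr k l"
  unfolding corr_def
  using mean_shift[OF bounded_products, of j k l] by (simp add: add_ac)

lemma corr_diag: "corr k k = complex_of_real (mean (\<lambda>n. (cmod (f n))\<^sup>2))"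
proof -
  have "bounded (range (\<lambda>n. (cmod (f n))\<^sup>2))"
    using bounded_partial_sums[of 1 1] by simp
  then have "mean (\<lambda>n. complex_of_real ((cmod (f n))\<^sup>2)) = complex_of_real (mean (\<lambda>n. (cmod (f n))\<^sup>2))"
    by (rule mean_linear[OF bounded_linear_of_real])
  then have "corr 0 0 = complex_of_real (mean (\<lambda>n. (cmod (f n))\<^sup>2))"
    by (simp add: corr_def complex_norm_square del: of_real_power)
  then show ?thesis using corr_shift[of 0 k 0] by simp
qed

lemma energy_expand:
  "complex_of_real (energy z L) = (\<Sum>k<L. \<Sum>l<L. cnj z ^ k * z ^ l * corr k l)"
proof -
  have eq: "complex_of_real ((cmod (\<Sum>k<L. cnj z ^ k * f (n + k)))\<^sup>2)
      = (\<Sum>k<L. \<Sum>l<L. cnj z ^ k * z ^ l * (f (n + k) * cnj (f (n + l))))" for n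
    unfolding complex_norm_square cnj_sum sum_product
    by (intro sum.cong refl) (simp add: mult_ac)
  have b1: "bounded (range (\<lambda>n. cnj z ^ k * z ^ l * (f (n + k) * cnj (f (n + l)))))" for k l
    using bounded_linear_image[OF bounded_products bounded_linear_mult_right[of "cnj z ^ k * z ^ l"]]
    by (simp add: image_image)
  have b2: "bounded (range (\<lambda>n. \<Sum>l<L. cnj z ^ k * z ^ l * (f (n + k) * cnj (f (n + l)))))" for k
  proof (induction L)
    case (Suc L)
    show ?case using bounded_plus_comp[OF Suc b1[of k L]] by simp
  qed simp
  have "complex_of_real (energy z L)
      = mean (\<lambda>n. complex_of_real ((cmod (\<Sum>k<L. cnj z ^ k * f (n + k)))\<^sup>2))"
    unfolding energy_def
    by (rule mean_linear[OF bounded_linear_of_real bounded_partial_sums, symmetric])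
  also have "\<dots> = (\<Sum>k<L. \<Sum>l<L. cnj z ^ k * z ^ l * corr k l)"
    unfolding eq corr_def
    by (simp only: mean_sum[OF b2] mean_sum[OF b1] mean_mult_left[OF bounded_products])
  finally show ?thesis .
qed

text \<open>
  The twisted sum of length \<open>2 * L\<close> consists of two shifted copies of the one of length \<open>L\<close>. Hence the
  normalised energy decreases along the powers of two, and a Dini argument becomes possible.
\<close>

lemma energy_double:
  assumes z: "cmod z = 1"
  shows "energy z (2 * L) \<le> 4 * energy z L"
proof -
  define w where "w n = (\<Sum>k<L. cnj z ^ k * f (n + k))" for n
  have bw: "bounded (range (\<lambda>n. (cmod (w n))\<^sup>2))" unfolding w_def by (rule bounded_partial_sums)
  have bw': "bounded (range (\<lambda>n. (cmod (w (n + L)))\<^sup>2))"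
    by (rule bounded_subset[OF bw]) auto
  have b2: "bounded (range (\<lambda>n. 2 * (cmod (w n))\<^sup>2))" "bounded (range (\<lambda>n. 2 * (cmod (w (n + L)))\<^sup>2))"
    using bounded_scaleR_comp[OF bw, of 2] bounded_scaleR_comp[OF bw', of 2] by simp_all
  have split: "(\<Sum>k<2 * L. cnj z ^ k * f (n + k)) = w n + cnj z ^ L * w (n + L)" for n
  proof -
    have "(\<Sum>k<L + L'. cnj z ^ k * f (n + k)) = w n + (\<Sum>k<L'. cnj z ^ (L + k) * f (n + (L + k)))" for L'
      by (induction L') (simp_all add: w_def add_ac)
    from this[of L] show ?thesis
      unfolding mult_2 by (simp add: w_def sum_distrib_left power_add mult_ac add_ac)
  qed
  have "(cmod (\<Sum>k<2 * L. cnj z ^ k * f (n + k)))\<^sup>2 \<le> 2 * (cmod (w n))\<^sup>2 + 2 * (cmod (w (n + L)))\<^sup>2" for n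
  proof -
    have "cmod (w n + cnj z ^ L * w (n + L)) \<le> cmod (w n) + cmod (w (n + L))"
      using norm_triangle_ineq[of "w n" "cnj z ^ L * w (n + L)"] z by (simp add: norm_mult norm_power)
    then have "(cmod (w n + cnj z ^ L * w (n + L)))\<^sup>2 \<le> (cmod (w n) + cmod (w (n + L)))\<^sup>2"
      by (intro power_mono) auto
    also have "\<dots> \<le> 2 * (cmod (w n))\<^sup>2 + 2 * (cmod (w (n + L)))\<^sup>2"
      using sum_squares_ge_zero[of "cmod (w n) - cmod (w (n + L))" 0]
      by (simp add: power2_eq_square algebra_simps)
    finally show ?thesis by (simp add: split)
  qed
  then have "energy z (2 * L) \<le> mean (\<lambda>n. 2 * (cmod (w n))\<^sup>2 + 2 * (cmod (w (n + L)))\<^sup>2)"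
    unfolding energy_def
    by (intro mean_mono bounded_partial_sums bounded_plus_comp b2) auto
  also have "\<dots> = 2 * energy z L + 2 * mean (\<lambda>n. (cmod (w (n + L)))\<^sup>2)"
    by (subst mean_add[OF b2]) (simp add: mean_mult_left[OF bw] mean_mult_left[OF bw'],
        simp add: energy_def w_def[abs_def])
  also have "mean (\<lambda>n. (cmod (w (n + L)))\<^sup>2) = energy z L"
    using mean_shift[OF bw, of L] by (simp add: energy_def w_def[abs_def])
  finally show ?thesis by simp
qed

lemma energy_dyadic_antimono:
  assumes z: "cmod z = 1" and ij: "i \<le> j"
  shows "energy z (2 ^ j) / 4 ^ j \<le> energy z (2 ^ i) / 4 ^ i"
  using ij
proof (induction rule: dec_induct)
  case (step j)
  have "energy z (2 ^ Suc j) / 4 ^ Suc j \<le> energy z (2 ^ j) / 4 ^ j"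
    using energy_double[OF z, of "2 ^ j"] by (simp add: field_simps)
  with step show ?case by linarith
qed simp

text \<open>
  As a function of \<open>z\<close> on the circle, the energy is a nonnegative trigonometric polynomial of degree
  less than \<open>L\<close>, with coefficients \<open>(L - d) * corr d 0\<close> for \<open>d \<ge> 0\<close>. Its mean square, which is the sum of the squared
  moduli of its coefficients, is at most its maximum times its mean. Averages over the roots of
  unity of order \<open>2 * L\<close> are exact for the degrees involved.
\<close>

lemma corr_sum_le:
  assumes E: "\<And>z. cmod z = 1 \<Longrightarrow> energy z L \<le> e * (real L)\<^sup>2" and L: "0 < L"
  shows "(\<Sum>d<L. (real (L - d))\<^sup>2 * (cmod (corr d 0))\<^sup>2)
    \<le> e * real L ^ 3 * mean (\<lambda>n. (cmod (f n))\<^sup>2)"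
proof -
  define R where "R = 2 * L"
  define w where "w r = cis (2 * pi * real r / R)" for r
  define g0 where "g0 = mean (\<lambda>n. (cmod (f n))\<^sup>2)"
  have R: "0 < R" using L by (simp add: R_def)
  have w: "cmod (w r) = 1" "w r * cnj (w r) = 1" for r
    by (simp_all add: w_def complex_mult_cnj cis.code power2_eq_square[symmetric])
  \<comment> \<open>The pairs of lag \<open>k - l = m - (L - 1)\<close>.\<close>
  define S where "S m = {(k, l). k < L \<and> l < L \<and> k + (L - 1 - l) = m}" for m
  define g where "g m = (\<Sum>(k, l)\<in>S m. corr k l)" for m
  have finS: "finite (S m)" for m
    by (rule finite_subset[of _ "{..<L} \<times> {..<L}"]) (auto simp: S_def)
  \<comment> \<open>Only the diagonal correlations survive the average over the roots of unity.\<close>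
  have "complex_of_real (\<Sum>r<R. energy (w r) L)
      = (\<Sum>r<R. \<Sum>k<L. \<Sum>l<L. cnj (w r) ^ k * w r ^ l * corr k l)"
    by (simp add: energy_expand)
  also have "\<dots> = (\<Sum>k<L. \<Sum>l<L. \<Sum>r<R. cnj (w r) ^ k * w r ^ l * corr k l)"
    by (rule trans[OF sum.swap], rule sum.cong[OF refl], rule sum.swap)
  also have "\<dots> = (\<Sum>k<L. \<Sum>l<L. (if k = l then of_nat R else 0) * corr k l)"
    unfolding sum_distrib_right[symmetric] w_def
    by (intro sum.cong refl arg_cong2[of _ _ _ _ "(*)"] sum_cis_pairs[OF R]) (auto simp: R_def)
  also have "\<dots> = complex_of_real (R * L * g0)"
  proof -
    have "(\<Sum>l<L. (if k = l then of_nat R else 0) * corr k l) = of_nat R * complex_of_real g0"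
      if "k < L" for k
    proof -
      have "(\<Sum>l<L. (if k = l then of_nat R else 0) * corr k l)
          = (\<Sum>l<L. if k = l then of_nat R * corr k l else 0)"
        by (intro sum.cong refl) simp
      then show ?thesis using that by (simp add: corr_diag g0_def)
    qed
    then show ?thesis by simp
  qed
  finally have total: "(\<Sum>r<R. energy (w r) L) = R * L * g0" unfolding of_real_eq_iff .
  \<comment> \<open>Multiplication by the unimodular number \<open>cnj (w r) ^ (L - 1)\<close> makes all frequencies nonnegative, so
    that Parseval's identity applies; \<open>g\<close> collects the correlations of equal frequency.\<close>
  have four: "energy (w r) L = cmod (\<Sum>m<R. cnj (w r) ^ m * g m)" for r
  proof -
    have "(\<Sum>m<R. cnj (w r) ^ m * g m) = (\<Sum>m<R. \<Sum>(k, l)\<in>S m. cnj (w r) ^ (k + (L - 1 - l)) * corr k l)"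
      unfolding g_def sum_distrib_left by (intro sum.cong refl) (auto simp: S_def)
    also have "\<dots> = (\<Sum>x\<in>(\<Union>m<R. S m). case x of (k, l) \<Rightarrow> cnj (w r) ^ (k + (L - 1 - l)) * corr k l)"
      by (intro sum.UNION_disjoint[symmetric]) (auto simp: finS, auto simp: S_def)
    also have "(\<Union>m<R. S m) = {..<L} \<times> {..<L}" by (auto simp: S_def R_def)
    also have "(\<Sum>x\<in>{..<L} \<times> {..<L}. case x of (k, l) \<Rightarrow> cnj (w r) ^ (k + (L - 1 - l)) * corr k l)
        = (\<Sum>k<L. \<Sum>l<L. cnj (w r) ^ (k + (L - 1 - l)) * corr k l)"
      by (rule sum.cartesian_product[symmetric])
    also have "\<dots> = (\<Sum>k<L. \<Sum>l<L. cnj (w r) ^ (L - 1) * (cnj (w r) ^ k * w r ^ l * corr k l))"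
    proof (intro sum.cong refl)
      fix k l assume "l \<in> {..<L}"
      then have "cnj (w r) ^ (L - 1) * w r ^ l = cnj (w r) ^ (L - 1 - l) * (w r * cnj (w r)) ^ l"
        by (simp add: power_mult_distrib mult_ac flip: power_add)
      then show "cnj (w r) ^ (k + (L - 1 - l)) * corr k l
          = cnj (w r) ^ (L - 1) * (cnj (w r) ^ k * w r ^ l * corr k l)"
        by (simp add: w power_add mult_ac)
    qed
    also have "\<dots> = cnj (w r) ^ (L - 1) * complex_of_real (energy (w r) L)"
      by (simp add: energy_expand sum_distrib_left)
    finally show ?thesis by (simp add: norm_mult norm_power w energy_nonneg)
  qed
  have gd: "g (L - 1 + d) = of_nat (L - d) * corr d 0" if "d < L" for d
  proof -
    have "g (L - 1 + d) = (\<Sum>(k, l)\<in>(\<lambda>l. (l + d, l)) ` {..<L - d}. corr k l)"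
      unfolding g_def by (intro sum.cong refl) (use that in \<open>auto simp: S_def image_iff\<close>)
    also have "\<dots> = (\<Sum>l<L - d. corr (l + d) l)"
      by (subst sum.reindex) (auto simp: inj_on_def)
    also have "\<dots> = (\<Sum>l<L - d. corr d 0)"
      using corr_shift[of d _ 0] by (intro sum.cong refl) (simp add: add.commute)
    finally show ?thesis by simp
  qed
  have "(\<Sum>d<L. (real (L - d))\<^sup>2 * (cmod (corr d 0))\<^sup>2) = (\<Sum>d<L. (cmod (g (L - 1 + d)))\<^sup>2)"
    by (intro sum.cong refl) (simp only: lessThan_iff gd norm_mult norm_of_nat power_mult_distrib)
  also have "\<dots> = (\<Sum>m\<in>(\<lambda>d. L - 1 + d) ` {..<L}. (cmod (g m))\<^sup>2)"
    by (subst sum.reindex) (auto simp: inj_on_def)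
  also have "\<dots> \<le> (\<Sum>m<R. (cmod (g m))\<^sup>2)"
    by (intro sum_mono2) (auto simp: R_def)
  finally have "R * (\<Sum>d<L. (real (L - d))\<^sup>2 * (cmod (corr d 0))\<^sup>2) \<le> R * (\<Sum>m<R. (cmod (g m))\<^sup>2)"
    by (rule mult_left_mono) simp
  also have "\<dots> = (\<Sum>r<R. (energy (w r) L)\<^sup>2)"
    unfolding four using finite_parseval[OF R, of g] by (simp add: w_def)
  also have "\<dots> \<le> (\<Sum>r<R. e * (real L)\<^sup>2 * energy (w r) L)"
    unfolding power2_eq_square[of "energy _ _"]
    by (intro sum_mono mult_right_mono E w energy_nonneg)
  also have "\<dots> = e * (real L)\<^sup>2 * (R * L * g0)" by (simp add: sum_distrib_left[symmetric] total)
  also have "\<dots> = R * (e * real L ^ 3 * g0)" by (simp add: power2_eq_square power3_eq_cube)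
  finally show ?thesis using R by (simp add: g0_def)
qed

lemma energy_tendsto_zero:
  assumes z: "cmod z = 1"
    and zero: "uniform_limit UNIV (\<lambda>N m. avg m N (\<lambda>n. cnj z ^ n * f n)) (\<lambda>_. 0) sequentially"
  shows "(\<lambda>L. energy z L / (real L)\<^sup>2) \<longlonglongrightarrow> 0"
proof (rule tendstoI)
  fix e :: real assume e: "0 < e"
  have "eventually (\<lambda>L. \<forall>m\<in>UNIV. dist (avg m L (\<lambda>n. cnj z ^ n * f n)) 0 < sqrt (e / 2)) sequentially"
    using zero e by (intro uniform_limitD) auto
  with eventually_gt_at_top[of 0]
  show "eventually (\<lambda>L. dist (energy z L / (real L)\<^sup>2) 0 < e) sequentially"
  proof eventually_elim
    case (elim L)
    have "(cmod (\<Sum>k<L. cnj z ^ k * f (n + k)))\<^sup>2 \<le> (real L)\<^sup>2 * (e / 2)" for n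
    proof -
      have zz: "z * cnj z = 1" using z by (simp add: complex_norm_square[symmetric])
      have "(\<Sum>k<L. cnj z ^ k * f (n + k)) = z ^ n * (\<Sum>k<L. cnj z ^ (n + k) * f (n + k))"
        unfolding sum_distrib_left
        by (intro sum.cong refl) (simp add: power_add mult.assoc[symmetric] power_mult_distrib[symmetric] zz)
      also have "\<dots> = z ^ n * of_nat L * avg n L (\<lambda>n. cnj z ^ n * f n)"
        using elim by (simp add: avg_def scaleR_conv_of_real)
      finally have "cmod (\<Sum>k<L. cnj z ^ k * f (n + k)) = L * cmod (avg n L (\<lambda>n. cnj z ^ n * f n))"
        using z by (simp add: norm_mult norm_power)
      also have "\<dots> \<le> L * sqrt (e / 2)" using elim by (intro mult_left_mono) (auto simp: less_imp_le)
      finally have "(cmod (\<Sum>k<L. cnj z ^ k * f (n + k)))\<^sup>2 \<le> (L * sqrt (e / 2))\<^sup>2"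
        by (intro power_mono) auto
      then show ?thesis using e by (simp add: power_mult_distrib)
    qed
    then have "energy z L \<le> mean (\<lambda>n. (real L)\<^sup>2 * (e / 2))"
      unfolding energy_def by (intro mean_mono bounded_partial_sums) (auto simp: bounded_range_iff)
    then have "energy z L / (real L)\<^sup>2 \<le> e / 2"
      using elim by (simp add: mean_const field_simps)
    with e have "energy z L / (real L)\<^sup>2 < e" by linarith
    then show ?case using energy_nonneg[of z L] by (simp add: dist_norm)
  qed
qed

lemma energy_tendsto:
  assumes "(Z \<longlongrightarrow> z) F"
  shows "((\<lambda>j. energy (Z j) L) \<longlongrightarrow> energy z L) F"
proof -
  have "((\<lambda>j. complex_of_real (energy (Z j) L)) \<longlongrightarrow> complex_of_real (energy z L)) F"
    unfolding energy_expand by (intro tendsto_intros assms)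
  then show ?thesis by (simp only: tendsto_of_real_iff)
qed

text \<open>
  Dini's theorem: the continuous functions \<open>energy z (2 ^ j) / 4 ^ j\<close> decrease to zero on the unit
  circle, which is compact.
\<close>

lemma energy_uniformly_small:
  assumes zero: "\<And>z. cmod z = 1 \<Longrightarrow>
      uniform_limit UNIV (\<lambda>N m. avg m N (\<lambda>n. cnj z ^ n * f n)) (\<lambda>_. 0) sequentially"
    and e: "0 < e"
  shows "\<exists>i. \<forall>j\<ge>i. \<forall>z. cmod z = 1 \<longrightarrow> energy z (2 ^ j) \<le> e * 4 ^ j"
proof (rule ccontr)
  assume contr: "\<not> ?thesis"
  have "\<forall>i. \<exists>z. cmod z = 1 \<and> e < energy z (2 ^ i) / 4 ^ i"
  proof
    fix i
    obtain j z where jz: "i \<le> j" "cmod z = 1" "\<not> energy z (2 ^ j) \<le> e * 4 ^ j"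
      using contr by blast
    then have "e < energy z (2 ^ j) / 4 ^ j" by (simp add: field_simps)
    with energy_dyadic_antimono[OF jz(2,1)] jz(2)
    show "\<exists>z. cmod z = 1 \<and> e < energy z (2 ^ i) / 4 ^ i" by (intro exI[of _ z]) simp
  qed
  then obtain Z where Z: "\<And>i. cmod (Z i) = 1 \<and> e < energy (Z i) (2 ^ i) / 4 ^ i"
    unfolding choice_iff by auto
  have "\<forall>i. Z i \<in> sphere 0 1" using Z by simp
  then obtain z r where r: "z \<in> sphere 0 1" "strict_mono r" "(Z \<circ> r) \<longlonglongrightarrow> z"
    using compact_sphere[of 0 1, unfolded compact_def] by meson
  have ge: "e \<le> energy z (2 ^ J) / 4 ^ J" for J
  proof (rule tendsto_lowerbound)
    show "((\<lambda>j. energy ((Z \<circ> r) j) (2 ^ J) / 4 ^ J) \<longlongrightarrow> energy z (2 ^ J) / 4 ^ J) sequentially"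
      by (intro tendsto_divide energy_tendsto r(3) tendsto_const) simp
    show "eventually (\<lambda>j. e \<le> energy ((Z \<circ> r) j) (2 ^ J) / 4 ^ J) sequentially"
    proof (rule eventually_sequentiallyI)
      fix j assume "J \<le> j"
      then have "J \<le> r j" using seq_suble[OF r(2), of j] by linarith
      then show "e \<le> energy ((Z \<circ> r) j) (2 ^ J) / 4 ^ J"
        using energy_dyadic_antimono[of "Z (r j)" J "r j"] Z[of "r j"] by simp
    qed
  qed simp
  have z: "cmod z = 1" using r(1) by simp
  have "strict_mono (\<lambda>J. 2 ^ J :: nat)" by (rule strict_monoI) simp
  from LIMSEQ_subseq_LIMSEQ[OF energy_tendsto_zero[OF z zero[OF z]] this]
  have "(\<lambda>J. energy z (2 ^ J) / 4 ^ J) \<longlonglongrightarrow> 0"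
    by (simp add: o_def power_mult[symmetric] power2_eq_square power_mult_distrib[symmetric])
  then have "e \<le> 0" by (rule LIMSEQ_le_const) (use ge in auto)
  with e show False by simp
qed

text \<open>
  Weak almost periodicity makes the orbit of \<open>f\<close> precompact in the seminorm of the mean: a sequence of
  shifts has a pointwise convergent subsequence, and it converges in the mean by dominated
  convergence.
\<close>

lemma shifts_totally_bounded:
  assumes e: "0 < e"
  shows "\<exists>S. finite S \<and> (\<forall>k. \<exists>s\<in>S. mean (\<lambda>n. (cmod (f (n + k) - f (n + s)))\<^sup>2) < e)"
proof (rule ccontr)
  assume contr: "\<not> ?thesis"
  define D where "D k s = mean (\<lambda>n. (cmod (f (n + k) - f (n + s)))\<^sup>2)" for k s
  obtain C where C: "C > 0" "\<And>n. cmod (f n) \<le> C" using bounded_f by auto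
  have "\<exists>k :: nat \<Rightarrow> nat. \<forall>x. \<forall>y<x. e \<le> D (k x) (k y)"
  proof (rule dependent_wellorder_choice)
    fix x and k :: "nat \<Rightarrow> nat"
    have "finite (k ` {..<x})" by simp
    then have "\<not> (\<forall>r. \<exists>s\<in>k ` {..<x}. D r s < e)"
      using contr unfolding D_def[symmetric] not_ex de_Morgan_conj by iprover
    then show "\<exists>r. \<forall>y<x. e \<le> D r (k y)" by (auto simp: not_less)
  qed auto
  then obtain k :: "nat \<Rightarrow> nat" where "\<forall>x. \<forall>y<x. e \<le> D (k x) (k y)" by (elim exE)
  then have k: "\<And>x y. y < x \<Longrightarrow> e \<le> D (k x) (k y)" by simp
  obtain W' :: "nat filter" where W': "W' \<le> sequentially" "ultrafilter W'"
    using ultrafilter_exists[of sequentially] by auto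
  define q where "q l = Lim W' (\<lambda>i. f (k i + l))" for l
  have conv: "((\<lambda>i. f (k i + l)) \<longlongrightarrow> q l) W'" for l
    unfolding q_def by (rule ultrafilter_convergent[OF W'(2)]) (use C in \<open>auto simp: bounded_range_iff\<close>)
  have ev: "eventually (\<lambda>i. s \<le> i) W'" for s
    using W'(1) eventually_ge_at_top[of s] by (rule filter_leD)
  obtain i where i: "\<And>s. s \<le> i s" "\<And>l. (\<lambda>s. f (k (i s) + l)) \<longlonglongrightarrow> q l"
    using pointwise_limit_sequence[where g = "\<lambda>i l. f (k i + l)" and P = "\<lambda>s i. s \<le> i" and q = q and W = W',
        OF ultrafilter_not_bot[OF W'(2)] conv ev] by auto
  have qC: "cmod (q l) \<le> C" for l
    unfolding q_def by (intro ultrafilter_norm_Lim_le W'(2) C(2))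
  have "(\<lambda>s. mean (\<lambda>l. cmod (f (k (i s) + l) - q l))) \<longlonglongrightarrow> 0"
    by (rule mean_orbit_limit[OF f i(2)])
  from order_tendstoD(2)[OF this, of "e / (8 * C)"] e C
  obtain s where s: "\<And>t. s \<le> t \<Longrightarrow> mean (\<lambda>l. cmod (f (k (i t) + l) - q l)) < e / (8 * C)"
    by (auto simp: eventually_sequentially)
  define t where "t = Suc (max s (i s))"
  have t: "i s < i t" "s \<le> t" using i(1)[of t] by (auto simp: t_def)
  have bd: "bounded (range (\<lambda>l. cmod (f (k j + l) - q l)))" for j
    unfolding bounded_range_iff
  proof (intro exI[of _ "2 * C"] allI)
    fix l show "norm (cmod (f (k j + l) - q l)) \<le> 2 * C"
      using norm_triangle_ineq4[of "f (k j + l)" "q l"] C(2)[of "k j + l"] qC[of l] by simp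
  qed
  have bd2: "bounded (range (\<lambda>l. 2 * C * cmod (f (k j + l) - q l)))" for j
    using bounded_scaleR_comp[OF bd[of j], of "2 * C"] by simp
  have "(cmod (f (n + k (i t)) - f (n + k (i s))))\<^sup>2
      \<le> 2 * C * cmod (f (k (i t) + n) - q n) + 2 * C * cmod (f (k (i s) + n) - q n)" for n
  proof -
    define x where "x = cmod (f (k (i t) + n) - f (k (i s) + n))"
    have "x \<le> 2 * C"
      unfolding x_def using norm_triangle_ineq4[of "f (k (i t) + n)" "f (k (i s) + n)"]
        C(2)[of "k (i t) + n"] C(2)[of "k (i s) + n"] by linarith
    then have "x * x \<le> 2 * C * x" by (intro mult_right_mono) (auto simp: x_def)
    also have "x \<le> cmod (f (k (i t) + n) - q n) + cmod (f (k (i s) + n) - q n)"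
      unfolding x_def using norm_triangle_ineq4[of "f (k (i t) + n) - q n" "f (k (i s) + n) - q n"] by simp
    finally show ?thesis using C by (simp add: x_def power2_eq_square algebra_simps)
  qed
  then have "D (k (i t)) (k (i s)) \<le> mean (\<lambda>n. 2 * C * cmod (f (k (i t) + n) - q n) + 2 * C * cmod (f (k (i s) + n) - q n))"
    unfolding D_def
  proof (intro mean_mono bounded_plus_comp bd2)
    show "bounded (range (\<lambda>n. (cmod (f (n + k (i t)) - f (n + k (i s))))\<^sup>2))"
      unfolding bounded_range_iff
    proof (intro exI[of _ "(2 * C)\<^sup>2"] allI)
      fix n
      have "cmod (f (n + k (i t)) - f (n + k (i s))) \<le> 2 * C"
        using norm_triangle_ineq4[of "f (n + k (i t))" "f (n + k (i s))"]
          C(2)[of "n + k (i t)"] C(2)[of "n + k (i s)"] by linarith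
      then show "norm ((cmod (f (n + k (i t)) - f (n + k (i s))))\<^sup>2) \<le> (2 * C)\<^sup>2"
        using power_mono[of "cmod (f (n + k (i t)) - f (n + k (i s)))" "2 * C" 2] by simp
    qed
  qed
  also have "\<dots> = 2 * C * mean (\<lambda>n. cmod (f (k (i t) + n) - q n)) + 2 * C * mean (\<lambda>n. cmod (f (k (i s) + n) - q n))"
    by (subst mean_add[OF bd2 bd2]) (simp add: mean_mult_left[OF bd])
  also have "\<dots> < 2 * C * (e / (8 * C)) + 2 * C * (e / (8 * C))"
    using C s[OF t(2)] s[of s] by (intro add_strict_mono mult_strict_left_mono) auto
  also have "\<dots> < e" using C e by simp
  finally show False using k[OF t(1)] by simp
qed

text \<open>
  Suppose that the mean square \<open>g0\<close> of \<open>f\<close> is positive. Precompactness provides finitely many shifts \<open>s\<close>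
  such that every shift of \<open>f\<close> has correlation at least \<open>g0 / 2\<close> with one of them, so the mean square of the
  correlations cannot tend to zero. But \<open>corr k s = corr (k - s) 0\<close>, and the vanishing of the Fourier
  coefficients makes the mean square of \<open>corr d 0\<close> arbitrarily small, by the two estimates on
  the energy.
\<close>

theorem mean_zero_if_fourier_zero:
  assumes zero: "\<And>z. cmod z = 1 \<Longrightarrow>
      uniform_limit UNIV (\<lambda>N m. avg m N (\<lambda>n. cnj z ^ n * f n)) (\<lambda>_. 0) sequentially"
  shows "mean (\<lambda>n. cmod (f n)) = 0"
proof -
  define g0 where "g0 = mean (\<lambda>n. (cmod (f n))\<^sup>2)"
  obtain C where C: "C > 0" "\<And>n. cmod (f n) \<le> C" using bounded_f by auto
  have b1: "bounded (range (\<lambda>n. cmod (f n)))" using C by (auto simp: bounded_range_iff)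
  have b2: "bounded (range (\<lambda>n. (cmod (f (n + k)))\<^sup>2))" for k
    unfolding bounded_range_iff using C by (intro exI[of _ "C\<^sup>2"]) (simp add: power_mono)
  have "0 \<le> g0"
    using mean_mono[OF _ b2[of 0], of "\<lambda>_. 0"] by (simp add: g0_def mean_const bounded_range_iff)
  have "g0 = 0"
  proof (rule ccontr)
    assume "g0 \<noteq> 0"
    with \<open>0 \<le> g0\<close> have g0: "0 < g0" by simp
    obtain S where S: "finite S" "\<And>k. \<exists>s\<in>S. mean (\<lambda>n. (cmod (f (n + k) - f (n + s)))\<^sup>2) < g0"
      using shifts_totally_bounded[OF g0] by auto
    have large: "\<exists>s\<in>S. g0 / 2 \<le> cmod (corr k s)" for k
    proof -
      obtain s where s: "s \<in> S" "mean (\<lambda>n. (cmod (f (n + k) - f (n + s)))\<^sup>2) < g0"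
        using S(2) by blast
      have eq: "(cmod (f (n + k) - f (n + s)))\<^sup>2
          = ((cmod (f (n + k)))\<^sup>2 + (cmod (f (n + s)))\<^sup>2) - 2 * Re (f (n + k) * cnj (f (n + s)))" for n
        unfolding cmod_power2 by (simp add: power2_eq_square algebra_simps)
      have bR: "bounded (range (\<lambda>n. Re (f (n + k) * cnj (f (n + s)))))"
        using bounded_linear_image[OF bounded_products bounded_linear_Re, of k s] by (simp add: image_image)
      have bR2: "bounded (range (\<lambda>n. 2 * Re (f (n + k) * cnj (f (n + s)))))"
        using bounded_scaleR_comp[OF bR, of 2] by simp
      have "mean (\<lambda>n. (cmod (f (n + k) - f (n + s)))\<^sup>2) = (g0 + g0) - 2 * Re (corr k s)"
        unfolding eq corr_def
          mean_diff[OF bounded_plus_comp[OF b2 b2] bR2] mean_add[OF b2 b2]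
          mean_mult_left[OF bR] mean_linear[OF bounded_linear_Re bounded_products]
        using mean_shift[OF b2[of 0], simplified] by (simp add: g0_def)
      with s have "g0 / 2 \<le> Re (corr k s)" by simp
      then show ?thesis using complex_Re_le_cmod[of "corr k s"] s(1) by (meson order_trans)
    qed
    define c where "c = real (card S)"
    define K where "K = Max S"
    have "S \<noteq> {}" using S(2) by blast
    then have K: "\<And>s. s \<in> S \<Longrightarrow> s \<le> K" and c: "0 < c"
      using S(1) by (auto simp: K_def c_def card_gt_0_iff)
    \<comment> \<open>The two bounds on the correlations amount to \<open>g0 \<le> 64 * c * e\<close>.\<close>
    define e where "e = g0 / (65 * c)"
    have e: "0 < e" using g0 c by (simp add: e_def)
    obtain i where i: "\<And>j z. i \<le> j \<Longrightarrow> cmod z = 1 \<Longrightarrow> energy z (2 ^ j) \<le> e * 4 ^ j"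
      using energy_uniformly_small[OF zero e] by blast
    define j where "j = max i K + 2"
    define M where "M = (2 :: nat) ^ (j - 2)"
    have "K \<le> j - 2" by (simp add: j_def)
    then have "K < M" unfolding M_def using less_exp[of "j - 2"] by (rule le_less_trans)
    \<comment> \<open>The lags \<open>k - s\<close> used below stay under \<open>K + M < 2 * M = L / 2\<close>, where the weights \<open>L - d\<close> are at least \<open>L / 2\<close>.\<close>
    define L where "L = 4 * M"
    have L: "L = 2 ^ j" by (simp add: L_def M_def j_def power_add)
    have "0 < M" by (simp add: M_def)
    have E: "energy z L \<le> e * (real L)\<^sup>2" if "cmod z = 1" for z
    proof -
      have "(real L)\<^sup>2 = 4 ^ j" by (simp add: L power2_eq_square power_mult_distrib[symmetric])
      then show ?thesis using i[of j z] that by (simp add: L j_def)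
    qed
    have "(\<Sum>d<2 * M. (real (2 * M))\<^sup>2 * (cmod (corr d 0))\<^sup>2) \<le> (\<Sum>d<2 * M. (real (L - d))\<^sup>2 * (cmod (corr d 0))\<^sup>2)"
      by (intro sum_mono mult_right_mono power_mono) (auto simp: L_def)
    also have "\<dots> \<le> (\<Sum>d<L. (real (L - d))\<^sup>2 * (cmod (corr d 0))\<^sup>2)"
      by (rule sum_mono2) (auto simp: L_def)
    also have "\<dots> \<le> e * real L ^ 3 * g0"
      unfolding g0_def by (rule corr_sum_le[OF E]) (simp_all add: L)
    finally have "(real (2 * M))\<^sup>2 * (\<Sum>d<2 * M. (cmod (corr d 0))\<^sup>2) \<le> (real (2 * M))\<^sup>2 * (16 * e * real M * g0)"
      by (simp add: sum_distrib_left L_def power2_eq_square power3_eq_cube mult_ac)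
    then have up: "(\<Sum>d<2 * M. (cmod (corr d 0))\<^sup>2) \<le> 16 * e * real M * g0"
      using \<open>0 < M\<close> by (simp only: mult_le_cancel_left_pos zero_less_power of_nat_0_less_iff)
    have "real M * (g0 / 2)\<^sup>2 = (\<Sum>k\<in>{K..<K + M}. (g0 / 2)\<^sup>2)" by simp
    also have "\<dots> \<le> (\<Sum>k\<in>{K..<K + M}. \<Sum>s\<in>S. (cmod (corr k s))\<^sup>2)"
    proof (rule sum_mono)
      fix k
      obtain s where s: "s \<in> S" "g0 / 2 \<le> cmod (corr k s)" using large by blast
      then have "(g0 / 2)\<^sup>2 \<le> (cmod (corr k s))\<^sup>2" using g0 by (intro power_mono) auto
      also have "\<dots> \<le> (\<Sum>s\<in>S. (cmod (corr k s))\<^sup>2)"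
        by (rule member_le_sum) (use s S(1) in auto)
      finally show "(g0 / 2)\<^sup>2 \<le> (\<Sum>s\<in>S. (cmod (corr k s))\<^sup>2)" .
    qed
    also have "\<dots> = (\<Sum>s\<in>S. \<Sum>k\<in>{K..<K + M}. (cmod (corr k s))\<^sup>2)" by (rule sum.swap)
    also have "\<dots> \<le> (\<Sum>s\<in>S. 16 * e * real M * g0)"
    proof (rule sum_mono)
      fix s assume "s \<in> S"
      then have sK: "s \<le> K" by (rule K)
      have "(\<Sum>k\<in>{K..<K + M}. (cmod (corr k s))\<^sup>2) = (\<Sum>k\<in>{K..<K + M}. (cmod (corr (k - s) 0))\<^sup>2)"
      proof (intro sum.cong refl)
        fix k assume "k \<in> {K..<K + M}"
        then have "k = (k - s) + s" using sK by simp
        then show "(cmod (corr k s))\<^sup>2 = (cmod (corr (k - s) 0))\<^sup>2"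
          using corr_shift[of "k - s" s 0] by simp
      qed
      also have "\<dots> = (\<Sum>d\<in>(\<lambda>k. k - s) ` {K..<K + M}. (cmod (corr d 0))\<^sup>2)"
        by (subst sum.reindex) (use sK in \<open>auto simp: inj_on_def\<close>)
      also have "\<dots> \<le> (\<Sum>d<2 * M. (cmod (corr d 0))\<^sup>2)"
        by (rule sum_mono2) (use \<open>K < M\<close> in auto)
      finally show "(\<Sum>k\<in>{K..<K + M}. (cmod (corr k s))\<^sup>2) \<le> 16 * e * real M * g0" using up by linarith
    qed
    also have "\<dots> = real M * (16 * c * e * g0)" by (simp add: c_def)
    finally have "(g0 / 2)\<^sup>2 \<le> 16 * c * e * g0" using \<open>0 < M\<close> by simp
    then show False using g0 c by (simp add: e_def power2_eq_square field_simps)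
  qed
  \<comment> \<open>From mean square to mean, by \<open>t \<le> d + t\<^sup>2 / d\<close>.\<close>
  have "mean (\<lambda>n. cmod (f n)) \<le> d" if d: "0 < d" for d
  proof -
    have "cmod (f n) \<le> d + 1 / d * (cmod (f n))\<^sup>2" for n
    proof -
      have "d * cmod (f n) \<le> d * d + (cmod (f n))\<^sup>2"
      proof (cases "cmod (f n) \<le> d")
        case True
        then have "d * cmod (f n) \<le> d * d" using d by (intro mult_left_mono) auto
        then show ?thesis using zero_le_power2[of "cmod (f n)"] by linarith
      next
        case False
        then have "d * cmod (f n) \<le> (cmod (f n))\<^sup>2" unfolding power2_eq_square by (intro mult_right_mono) auto
        then show ?thesis using d by (smt (verit) mult_pos_pos)
      qed
      then show ?thesis using d by (simp add: field_simps)
    qed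
    moreover have "bounded (range (\<lambda>n. 1 / d * (cmod (f n))\<^sup>2))"
      using bounded_scaleR_comp[OF b2[of 0], of "1 / d"] by simp
    ultimately have "mean (\<lambda>n. cmod (f n)) \<le> mean (\<lambda>n. d + 1 / d * (cmod (f n))\<^sup>2)"
      by (intro mean_mono b1 bounded_plus_comp) (auto simp: bounded_range_iff)
    also have "\<dots> = d + 1 / d * g0"
    proof -
      have "mean (\<lambda>n. 1 / d * (cmod (f n))\<^sup>2) = 1 / d * g0"
        unfolding g0_def by (rule mean_mult_left) (use b2[of 0] in simp)
      then show ?thesis
        using \<open>bounded (range (\<lambda>n. 1 / d * (cmod (f n))\<^sup>2))\<close>
        by (subst mean_add) (simp_all only: mean_const, simp_all add: bounded_range_iff)
    qed
    finally show ?thesis by (simp add: \<open>g0 = 0\<close>)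
  qed
  then have "mean (\<lambda>n. cmod (f n)) \<le> 0" by (rule dense_ge)
  moreover have "0 \<le> mean (\<lambda>n. cmod (f n))"
    using mean_mono[OF _ b1, of "\<lambda>_. 0"] by (simp add: mean_const bounded_range_iff)
  ultimately show ?thesis by simp
qed

end
end

corollary cesaro_null_if_fourier_zero:
  assumes f: "wap f" and zero: "\<And>z. cmod z = 1 \<Longrightarrow>
      uniform_limit UNIV (\<lambda>N m. avg m N (\<lambda>n. cnj z ^ n * f n)) (\<lambda>_. 0) sequentially"
  shows "(\<lambda>N. avg m N (\<lambda>n. cmod (f n))) \<longlonglongrightarrow> 0"
proof (rule tendsto_if_all_ultrafilters)
  fix W :: "nat filter" assume W: "ultrafilter W" "W \<le> sequentially"
  interpret window_mean W "\<lambda>_. m" "\<lambda>N. N"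
    by unfold_locales (use W in \<open>auto simp: filterlim_def\<close>)
  have "bounded (range (\<lambda>n. cmod (f n)))" using f by (auto simp: wap_def bounded_range_iff)
  from mean_tendsto[OF this] show "((\<lambda>N. avg m N (\<lambda>n. cmod (f n))) \<longlongrightarrow> 0) W"
    by (simp add: mean_zero_if_fourier_zero[OF f zero])
qed

section \<open>Linear sequences are weakly almost periodic\<close>

lemma uniform_boundedness:
  fixes \<Phi> :: "'i \<Rightarrow> 'a::banach \<Rightarrow> complex"
  assumes lin: "\<And>i. bounded_linear (\<Phi> i)" and bdd: "\<And>x. bounded (range (\<lambda>i. \<Phi> i x))"
  shows "\<exists>C\<ge>0. \<forall>i x. cmod (\<Phi> i x) \<le> C * norm x"
proof -
  define F where "F n = {x. \<forall>i. cmod (\<Phi> i x) \<le> real n}" for n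
  have closed: "closed (F n)" for n
  proof -
    have "F n = (\<Inter>i. {x. cmod (\<Phi> i x) \<le> real n})" by (auto simp: F_def)
    moreover have "closed {x. cmod (\<Phi> i x) \<le> real n}" for i
      by (intro closed_Collect_le continuous_intros bounded_linear.continuous_on[OF lin])
    ultimately show ?thesis by auto
  qed
  have "\<exists>n. interior (F n) \<noteq> {}"
  proof (rule ccontr)
    assume noint: "\<not> ?thesis"
    have "euclidean interior_of \<Union> (range F) = {}"
    proof -
      have "Met_TC.mtopology interior_of \<Union> (range F) = {}"
      proof (rule Met_TC.metric_Baire_category_alt)
        show "Met_TC.mcomplete TYPE('a)" using complete_UNIV by (simp add: mcomplete_iff_complete)
        fix S assume "S \<in> range F"
        then obtain n where n: "S = F n" by auto
        with noint have "interior (F n) = {}" by simp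
        then have "euclidean interior_of (F n) = {}"
          by (auto simp: interior_of_def interior_def)
        then show "closedin Met_TC.mtopology S \<and> Met_TC.mtopology interior_of S = {}"
          using closed[of n] n by simp
      qed simp
      then show ?thesis by simp
    qed
    moreover have "\<Union> (range F) = UNIV"
    proof -
      have "\<exists>n. x \<in> F n" for x
      proof -
        obtain c where "\<And>i. cmod (\<Phi> i x) \<le> c" using bdd[of x] by (auto simp: bounded_range_iff)
        then have "x \<in> F (nat \<lceil>c\<rceil>)" unfolding F_def using real_nat_ceiling_ge[of c] order_trans by blast
        then show ?thesis by blast
      qed
      then show ?thesis by auto
    qed
    ultimately show False by simp
  qed
  then obtain n x where "x \<in> interior (F n)" by auto
  then obtain r where r: "0 < r" "cball x r \<subseteq> F n" by (auto simp: mem_interior_cball)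
  have "cmod (\<Phi> i z) \<le> 2 * n / r * norm z" for i z
  proof (cases "z = 0")
    case True
    then show ?thesis by (simp add: linear_0[OF bounded_linear.linear[OF lin]])
  next
    case False
    define t where "t = r / norm z"
    have t: "0 < t" using r False by (simp add: t_def)
    have "x + t *\<^sub>R z \<in> cball x r" "x \<in> cball x r" using r False by (simp_all add: t_def dist_norm)
    then have "x + t *\<^sub>R z \<in> F n" "x \<in> F n" using r(2) by auto
    then have "cmod (\<Phi> i (x + t *\<^sub>R z)) \<le> n" "cmod (\<Phi> i x) \<le> n"
      by (auto simp: F_def)
    moreover have "\<Phi> i (x + t *\<^sub>R z) - \<Phi> i x = t *\<^sub>R \<Phi> i z"
      using bounded_linear.linear[OF lin[of i]] by (simp add: linear_add linear_cmul)
    moreover have "cmod (\<Phi> i (x + t *\<^sub>R z) - \<Phi> i x) \<le> cmod (\<Phi> i (x + t *\<^sub>R z)) + cmod (\<Phi> i x)"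
      by (rule norm_triangle_ineq4)
    ultimately have "t * cmod (\<Phi> i z) \<le> 2 * n" using t by simp
    then show ?thesis using r False by (simp add: t_def field_simps)
  qed
  then show ?thesis using r by (intro exI[of _ "2 * n / r"]) auto
qed

lemma cdual_linear: "\<psi> \<in> cdual \<Longrightarrow> bounded_linear \<psi>"
  by (simp add: cdual_def bounded_clinear_def)

lemma cdual_scaleC: "\<psi> \<in> cdual \<Longrightarrow> \<psi> (c *\<^sub>C x) = c * \<psi> x"
  by (simp add: cdual_def bounded_clinear_def scaleC_complex_def)

lemma cdualI:
  assumes "\<And>x y. \<psi> (x + y) = \<psi> x + \<psi> y" "\<And>c x. \<psi> (c *\<^sub>C x) = c * \<psi> x"
    and "\<And>x. cmod (\<psi> x) \<le> norm x * K"
  shows "\<psi> \<in> cdual"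
proof -
  have "bounded_linear \<psi>"
    by (rule bounded_linear_intro[of _ K])
      (use assms in \<open>simp_all add: scaleR_scaleC[where 'a = 'a] scaleR_conv_of_real\<close>)
  then show ?thesis using assms(2) by (simp add: cdual_def bounded_clinear_def scaleC_complex_def)
qed

lemma weakly_open_vimage: "\<psi> \<in> cdual \<Longrightarrow> open S \<Longrightarrow> openin weak_topology (\<psi> -` S)"
  unfolding weak_topology_def by (rule topology_generated_by_Basis) auto

text \<open>
  If no \<open>y\<close> were a limit, the weakly open sets that \<open>u\<close> eventually avoids along \<open>U\<close> would cover the weak
  closure of the range; a finite subcover would be avoided as well.
\<close>

lemma rel_weakly_compact_limit:
  fixes u :: "'i \<Rightarrow> 'a::complex_normed_vector"
  assumes comp: "rel_weakly_compact (range u)" and U: "ultrafilter U"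
  shows "\<exists>y. \<forall>\<psi>\<in>cdual. ((\<lambda>k. \<psi> (u k)) \<longlongrightarrow> \<psi> y) U"
proof (rule ccontr)
  assume contr: "\<not> ?thesis"
  define K where "K = (weak_topology :: 'a topology) closure_of (range u)"
  define G where "G = {V. openin weak_topology V \<and> eventually (\<lambda>k. u k \<notin> V) U}"
  have "\<exists>V\<in>G. y \<in> V" for y
  proof -
    obtain \<psi> where \<psi>: "\<psi> \<in> cdual" "\<not> ((\<lambda>k. \<psi> (u k)) \<longlongrightarrow> \<psi> y) U" using contr by auto
    then obtain S where S: "open S" "\<psi> y \<in> S" "\<not> eventually (\<lambda>k. \<psi> (u k) \<in> S) U"
      unfolding tendsto_def by auto
    then show ?thesis using weakly_open_vimage[OF \<psi>(1) S(1)] U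
      by (intro bexI[of _ "\<psi> -` S"]) (auto simp: G_def ultrafilter_not_eventually)
  qed
  then have "K \<subseteq> \<Union>G" by auto
  moreover have "compactin weak_topology K" using comp by (simp add: rel_weakly_compact_def K_def)
  ultimately obtain F where F: "finite F" "F \<subseteq> G" "K \<subseteq> \<Union>F"
    using compactinD[of weak_topology K G] by (auto simp: G_def)
  have "eventually (\<lambda>k. \<forall>V\<in>F. u k \<notin> V) U"
    using F by (intro eventually_ball_finite) (auto simp: G_def)
  moreover have "u k \<in> K" for k
    using closure_of_subset[of "range u" "weak_topology :: 'a topology"] by (auto simp: K_def)
  ultimately have "eventually (\<lambda>k. False) U" using F(3) by (auto elim!: eventually_mono)
  with U show False by (simp add: ultrafilter_def)
qed

lemma rel_weakly_compact_bounded: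
  fixes u :: "nat \<Rightarrow> 'a::complex_normed_vector"
  assumes comp: "rel_weakly_compact (range u)" and \<psi>: "\<psi> \<in> cdual"
  shows "bounded (range (\<lambda>k. \<psi> (u k)))"
proof -
  have "continuous_map weak_topology euclidean \<psi>"
    using weakly_open_vimage[OF \<psi>] by (auto simp: continuous_map_def vimage_def)
  from image_compactin[OF comp[unfolded rel_weakly_compact_def] this]
  have "bounded (\<psi> ` (weak_topology closure_of range u))"
    by (auto intro: compact_imp_bounded)
  moreover have "range (\<lambda>k. \<psi> (u k)) \<subseteq> \<psi> ` (weak_topology closure_of range u)"
    using closure_of_subset[of "range u" "weak_topology :: 'a topology"] by auto
  ultimately show ?thesis by (rule bounded_subset)
qed

context
  fixes T :: "'a::complex_banach \<Rightarrow> 'a"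
  assumes T: "rel_weakly_compact_operator T"
begin

lemma power_cdual: "\<psi> \<in> cdual \<Longrightarrow> (\<lambda>z. \<psi> ((T ^^ n) z)) \<in> cdual"
proof (induction n)
  case (Suc n)
  have "bounded_linear T" "\<And>c x. T (c *\<^sub>C x) = c *\<^sub>C T x"
    using T by (auto simp: rel_weakly_compact_operator_def bounded_clinear_def)
  then show ?case
    using Suc bounded_linear_compose[of "\<lambda>z. \<psi> ((T ^^ n) z)" T]
    by (simp add: cdual_def bounded_clinear_def funpow_swap1)
qed simp

lemma orbit_compact: "rel_weakly_compact (range (\<lambda>n. (T ^^ n) x))"
  using T by (simp add: rel_weakly_compact_operator_def)

lemma orbit_norm_bound:
  assumes "\<psi> \<in> cdual"
  shows "\<exists>C\<ge>0. \<forall>n z. cmod (\<psi> ((T ^^ n) z)) \<le> C * norm z"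
  by (rule uniform_boundedness)
    (use cdual_linear[OF power_cdual[OF assms]] rel_weakly_compact_bounded[OF orbit_compact assms] in auto)

text \<open>
  Along \<open>U\<close>, the orbit converges weakly to some \<open>y\<close>; along \<open>V\<close>, the functionals \<open>\<psi> \<circ> T ^^ n\<close> converge
  pointwise to some \<open>\<eta>\<close>, which is continuous by the uniform boundedness principle. Both iterated limits
  equal \<open>\<eta> y\<close>.
\<close>

theorem linear_sequence_wap:
  assumes \<psi>: "\<psi> \<in> cdual"
  shows "wap (\<lambda>n. \<psi> ((T ^^ n) x))"
  unfolding wap_def
proof (intro conjI allI impI)
  show "bounded (range (\<lambda>n. \<psi> ((T ^^ n) x)))" by (rule rel_weakly_compact_bounded[OF orbit_compact \<psi>])
  fix U V :: "nat filter" assume U: "ultrafilter U" and V: "ultrafilter V"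
  obtain C where C: "0 \<le> C" "\<And>n z. cmod (\<psi> ((T ^^ n) z)) \<le> C * norm z"
    using orbit_norm_bound[OF \<psi>] by auto
  define \<eta> where "\<eta> z = Lim V (\<lambda>n. \<psi> ((T ^^ n) z))" for z
  have conv: "((\<lambda>n. \<psi> ((T ^^ n) z)) \<longlongrightarrow> \<eta> z) V" for z
    unfolding \<eta>_def by (rule ultrafilter_convergent[OF V rel_weakly_compact_bounded[OF orbit_compact \<psi>]])
  have \<eta>: "\<eta> \<in> cdual"
  proof (rule cdualI[of _ C])
    fix y z c
    note lin = bounded_linear.linear[OF cdual_linear[OF power_cdual[OF \<psi>]]]
    show "\<eta> (y + z) = \<eta> y + \<eta> z"
      unfolding \<eta>_def[of "y + z"] linear_add[OF lin]
      by (intro ultrafilter_LimI[OF V] tendsto_add conv)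
    show "\<eta> (c *\<^sub>C z) = c * \<eta> z"
      unfolding \<eta>_def[of "c *\<^sub>C z"] cdual_scaleC[OF power_cdual[OF \<psi>]]
      by (intro ultrafilter_LimI[OF V] tendsto_mult tendsto_const conv)
    show "cmod (\<eta> z) \<le> norm z * C"
      unfolding \<eta>_def by (rule ultrafilter_norm_Lim_le[OF V]) (use C in \<open>simp add: mult.commute\<close>)
  qed
  obtain y where y: "\<And>\<xi>. \<xi> \<in> cdual \<Longrightarrow> ((\<lambda>k. \<xi> ((T ^^ k) x)) \<longlongrightarrow> \<xi> y) U"
    using rel_weakly_compact_limit[OF orbit_compact U] by blast
  have "Lim U (\<lambda>k. Lim V (\<lambda>n. \<psi> ((T ^^ (k + n)) x))) = Lim U (\<lambda>k. \<eta> ((T ^^ k) x))"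
  proof -
    have "(T ^^ (k + n)) x = (T ^^ n) ((T ^^ k) x)" for k n
      using funpow_add[of n k T] by (simp add: add.commute)
    then show ?thesis by (simp only: \<eta>_def)
  qed
  also have "\<dots> = \<eta> y" by (rule ultrafilter_LimI[OF U y[OF \<eta>]])
  also have "\<eta> y = Lim V (\<lambda>n. \<psi> ((T ^^ n) y))" by (simp add: \<eta>_def)
  also have "\<dots> = Lim V (\<lambda>n. Lim U (\<lambda>k. \<psi> ((T ^^ (k + n)) x)))"
  proof -
    have "Lim U (\<lambda>k. \<psi> ((T ^^ (k + n)) x)) = \<psi> ((T ^^ n) y)" for n
      using ultrafilter_LimI[OF U y[OF power_cdual[OF \<psi>, of n]]]
      by (simp add: funpow_add add.commute[of _ n])
    then show ?thesis by simp
  qed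
  finally show "Lim U (\<lambda>k. Lim V (\<lambda>n. \<psi> ((T ^^ (k + n)) x)))
      = Lim V (\<lambda>n. Lim U (\<lambda>k. \<psi> ((T ^^ (k + n)) x)))" .
qed

end

section \<open>The Hahn-Banach theorem\<close>

definition sublinear :: "('a::real_vector \<Rightarrow> real) \<Rightarrow> bool"
  where "sublinear q \<longleftrightarrow> (\<forall>x y. q (x + y) \<le> q x + q y) \<and> (\<forall>t>0. \<forall>x. q (t *\<^sub>R x) = t * q x)"

lemma sublinear_add: "sublinear q \<Longrightarrow> q (x + y) \<le> q x + q y"
  and sublinear_scale: "sublinear q \<Longrightarrow> 0 < t \<Longrightarrow> q (t *\<^sub>R x) = t * q x"
  by (auto simp: sublinear_def)

lemma sublinear_zero: "sublinear q \<Longrightarrow> q 0 = 0"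
  using sublinear_scale[of q 2 0] by simp

lemma sublinear_scale0: "sublinear q \<Longrightarrow> 0 \<le> t \<Longrightarrow> q (t *\<^sub>R x) = t * q x"
  by (cases "t = 0") (auto simp: sublinear_scale sublinear_zero)

lemma sublinear_minus: "sublinear q \<Longrightarrow> - q (- x) \<le> q x"
  using sublinear_add[of q x "- x"] sublinear_zero[of q] by simp

text \<open>
  The largest sublinear functional below \<open>m\<close> that is at most \<open>- m b\<close> at \<open>- b\<close>. It reduces to \<open>m\<close> precisely when \<open>m\<close> is
  additive in the direction \<open>b\<close>.
\<close>

lemma sublinear_directional:
  fixes m :: "'a::real_vector \<Rightarrow> real" and b :: 'a
  assumes m: "sublinear m"
  defines "r \<equiv> \<lambda>v. INF t\<in>{0..}. m (v + t *\<^sub>R b) - t * m b"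
  shows "sublinear r" and "0 \<le> t \<Longrightarrow> r v \<le> m (v + t *\<^sub>R b) - t * m b"
proof -
  have r_eq: "r v = (INF t\<in>{0..}. m (v + t *\<^sub>R b) - t * m b)" for v
    by (simp add: r_def)
  have lower: "- m (- v) \<le> m (v + t *\<^sub>R b) - t * m b" if "0 \<le> t" for v t
    using sublinear_add[OF m, of "v + t *\<^sub>R b" "- v"] sublinear_scale0[OF m that, of b] by simp
  show le: "r v \<le> m (v + t *\<^sub>R b) - t * m b" if "0 \<le> t" for v t
    unfolding r_eq by (rule cINF_lower) (use that lower in \<open>auto intro!: bdd_belowI2\<close>)
  have scale: "r (c *\<^sub>R v) \<le> c * r v" if c: "0 < c" for c v
  proof -
    have "r (c *\<^sub>R v) / c \<le> m (v + t *\<^sub>R b) - t * m b" if "0 \<le> t" for t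
    proof -
      have "r (c *\<^sub>R v) \<le> m (c *\<^sub>R v + (c * t) *\<^sub>R b) - (c * t) * m b"
        using c that by (intro le) simp
      also have "\<dots> = c * (m (v + t *\<^sub>R b) - t * m b)"
        using sublinear_scale[OF m c, of "v + t *\<^sub>R b"] by (simp add: scaleR_add_right algebra_simps)
      finally show ?thesis using c by (simp add: field_simps)
    qed
    then have "r (c *\<^sub>R v) / c \<le> r v" unfolding r_eq[of v] by (intro cINF_greatest) auto
    then show ?thesis using c by (simp add: field_simps)
  qed
  show "sublinear r"
    unfolding sublinear_def
  proof (intro conjI allI impI)
    fix v w
    have "r (v + w) - (m (w + s *\<^sub>R b) - s * m b) \<le> m (v + t *\<^sub>R b) - t * m b" if "0 \<le> t" "0 \<le> s" for t s
    proof -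
      have "r (v + w) \<le> m ((v + w) + (t + s) *\<^sub>R b) - (t + s) * m b" using that by (intro le) simp
      also have "m ((v + w) + (t + s) *\<^sub>R b) \<le> m (v + t *\<^sub>R b) + m (w + s *\<^sub>R b)"
        using sublinear_add[OF m, of "v + t *\<^sub>R b" "w + s *\<^sub>R b"] by (simp add: algebra_simps)
      finally show ?thesis by (simp add: algebra_simps)
    qed
    then have "r (v + w) - (m (w + s *\<^sub>R b) - s * m b) \<le> r v" if "0 \<le> s" for s
      using that unfolding r_eq[of v] by (intro cINF_greatest) auto
    then have "r (v + w) - r v \<le> m (w + s *\<^sub>R b) - s * m b" if "0 \<le> s" for s
      using that by (simp add: algebra_simps)
    then have "r (v + w) - r v \<le> r w" unfolding r_eq[of w] by (intro cINF_greatest) auto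
    then show "r (v + w) \<le> r v + r w" by simp
  next
    fix c :: real and v assume c: "0 < c"
    have "r v \<le> inverse c * r (c *\<^sub>R v)" using scale[of "inverse c" "c *\<^sub>R v"] c by simp
    then have "c * r v \<le> r (c *\<^sub>R v)" using c by (simp add: field_simps)
    with scale[OF c] show "r (c *\<^sub>R v) = c * r v" by (simp add: order_antisym)
  qed
qed

lemma minimal_sublinear:
  assumes q: "sublinear (q :: 'a::real_vector \<Rightarrow> real)"
  obtains m where "sublinear m" "\<And>x. m x \<le> q x"
    "\<And>m'. sublinear m' \<Longrightarrow> (\<And>x. m' x \<le> m x) \<Longrightarrow> m' = m"
proof -
  define A where "A = {m. sublinear m \<and> (\<forall>x. m x \<le> q x)}"
  have po: "partial_order_on A (relation_of (\<lambda>x y. y \<le> x) A)"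
    by (rule partial_order_on_relation_ofI) auto
  have ch: "\<exists>u\<in>A. \<forall>m\<in>C. u \<le> m" if C: "C \<in> Chains (relation_of (\<lambda>x y. y \<le> x) A)" for C
  proof (cases "C = {}")
    case True
    then show ?thesis using q by (auto simp: A_def)
  next
    case ne: False
    have CA: "C \<subseteq> A" using C unfolding Chains_def relation_of_def by blast
    have tot: "m \<le> m' \<or> m' \<le> m" if "m \<in> C" "m' \<in> C" for m m'
      using C that unfolding Chains_def relation_of_def by blast
    have sub: "sublinear m" if "m \<in> C" for m using that CA by (auto simp: A_def)
    define u where "u x = (INF m\<in>C. m x)" for x
    have bdd: "bdd_below ((\<lambda>m. m x) ` C)" for x
    proof (rule bdd_belowI2)
      fix m assume "m \<in> C"
      then have "sublinear m" "m (- x) \<le> q (- x)" using CA by (auto simp: A_def)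
      then show "- q (- x) \<le> m x" using sublinear_minus[of m x] by linarith
    qed
    have le: "u x \<le> m x" if "m \<in> C" for m x
      unfolding u_def by (rule cINF_lower[OF bdd that])
    have ge: "a \<le> u x" if "\<And>m. m \<in> C \<Longrightarrow> a \<le> m x" for a x
      unfolding u_def by (rule cINF_greatest[OF ne that])
    have "sublinear u"
      unfolding sublinear_def
    proof (intro conjI allI impI)
      fix x y
      have "u (x + y) - m' y \<le> m x" if "m \<in> C" "m' \<in> C" for m m'
        using tot[OF that]
      proof
        assume "m \<le> m'"
        then show ?thesis using le[OF that(1), of "x + y"] sublinear_add[OF sub[OF that(1)], of x y]
          by (auto simp: le_fun_def dest: spec[of _ y])
      next
        assume "m' \<le> m"
        then show ?thesis using le[OF that(2), of "x + y"] sublinear_add[OF sub[OF that(2)], of x y]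
          by (auto simp: le_fun_def dest: spec[of _ x])
      qed
      then have "u (x + y) - m' y \<le> u x" if "m' \<in> C" for m' using that by (intro ge) auto
      then have "u (x + y) - u x \<le> u y" by (intro ge) (simp add: algebra_simps)
      then show "u (x + y) \<le> u x + u y" by simp
    next
      fix t :: real and x assume t: "0 < t"
      have "u (t *\<^sub>R x) / t \<le> u x"
      proof (rule ge)
        fix m assume m: "m \<in> C"
        show "u (t *\<^sub>R x) / t \<le> m x"
          using le[OF m, of "t *\<^sub>R x"] sublinear_scale[OF sub[OF m] t, of x] t by (simp add: field_simps)
      qed
      moreover have "t * u x \<le> u (t *\<^sub>R x)"
      proof (rule ge)
        fix m assume m: "m \<in> C"
        show "t * u x \<le> m (t *\<^sub>R x)"
          using le[OF m, of x] sublinear_scale[OF sub[OF m] t, of x] t by simp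
      qed
      ultimately show "u (t *\<^sub>R x) = t * u x" using t by (simp add: field_simps)
    qed
    moreover have "u x \<le> q x" for x
    proof -
      obtain m where "m \<in> C" using ne by auto
      then show ?thesis using le[of m x] CA by (auto simp: A_def intro: order_trans)
    qed
    ultimately show ?thesis using le by (intro bexI[of _ u]) (auto simp: A_def le_fun_def)
  qed
  from predicate_Zorn[OF po ch] obtain m where m: "m \<in> A" "\<forall>a\<in>A. a \<le> m \<longrightarrow> a = m" by auto
  show thesis
  proof (rule that[of m])
    show "sublinear m" "\<And>x. m x \<le> q x" using m(1) by (auto simp: A_def)
    fix m' assume m': "sublinear m'" "\<And>x. m' x \<le> m x"
    have "m' x \<le> q x" for x
      using m'(2)[of x] m(1) by (auto simp: A_def intro: order_trans)
    then have "m' \<in> A" using m' by (auto simp: A_def)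
    then show "m' = m" using m(2) m'(2) by (auto simp: le_fun_def)
  qed
qed

text \<open>
  A minimal sublinear functional is linear, because passing to any of its directional modifications
  does not change it. Minimising below the modification of \<open>q\<close> in direction \<open>b\<close> forces the value at \<open>b\<close>.
\<close>

theorem hahn_banach_sublinear:
  assumes q: "sublinear (q :: 'a::real_vector \<Rightarrow> real)"
  obtains g where "linear g" "\<And>x. g x \<le> q x" "g b = q b"
proof -
  define r where "r v = (INF t\<in>{0..}. q (v + t *\<^sub>R b) - t * q b)" for v
  have r: "sublinear r" "\<And>t v. 0 \<le> t \<Longrightarrow> r v \<le> q (v + t *\<^sub>R b) - t * q b"
    unfolding r_def[abs_def] by (rule sublinear_directional[OF q])+
  obtain g where g: "sublinear g" "\<And>x. g x \<le> r x"
      "\<And>m'. sublinear m' \<Longrightarrow> (\<And>x. m' x \<le> g x) \<Longrightarrow> m' = g"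
    using minimal_sublinear[OF r(1)] by metis
  have super: "g v + g c \<le> g (v + c)" for v c
  proof -
    define s where "s v = (INF t\<in>{0..}. g (v + t *\<^sub>R c) - t * g c)" for v
    have s: "sublinear s" "\<And>t v. 0 \<le> t \<Longrightarrow> s v \<le> g (v + t *\<^sub>R c) - t * g c"
      unfolding s_def[abs_def] by (rule sublinear_directional[OF g(1)])+
    have "s x \<le> g x" for x using s(2)[of 0 x] by simp
    with s(1) have "s = g" by (rule g(3))
    with s(2)[of 1 v] show ?thesis by simp
  qed
  have add: "g (v + c) = g v + g c" for v c
    using super[of v c] sublinear_add[OF g(1), of v c] by simp
  have neg: "g (- v) = - g v" for v
    using add[of v "- v"] sublinear_zero[OF g(1)] by simp
  have "linear g"
  proof (rule linearI[OF add])
    fix t :: real and v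
    show "g (t *\<^sub>R v) = t *\<^sub>R g v"
    proof (cases "0 \<le> t")
      case True
      then show ?thesis by (simp add: sublinear_scale0[OF g(1)])
    next
      case False
      then show ?thesis using sublinear_scale[OF g(1), of "- t" v] neg[of "t *\<^sub>R v"] by simp
    qed
  qed
  moreover have le: "g x \<le> q x" for x
    using g(2)[of x] r(2)[of 0 x] by simp
  moreover have "g b = q b"
  proof -
    have "g (- b) \<le> - q b"
      using g(2)[of "- b"] r(2)[of 1 "- b"] sublinear_zero[OF q] by simp
    with neg[of b] le[of b] show ?thesis by simp
  qed
  ultimately show thesis by (rule that)
qed

text \<open>
  The complex form for a seminorm. The factor \<open>2\<close> comes from estimating the real and the imaginary
  part separately.
\<close>

theorem hahn_banach_cdual:
  fixes p :: "'a::complex_normed_vector \<Rightarrow> real"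
  assumes add: "\<And>x y. p (x + y) \<le> p x + p y"
    and scale: "\<And>c x. p (c *\<^sub>C x) = cmod c * p x"
    and bound: "\<And>x. p x \<le> K * norm x"
  shows "\<exists>\<psi>\<in>cdual. (\<forall>x. cmod (\<psi> x) \<le> 2 * p x) \<and> Re (\<psi> b) = p b"
proof -
  have "sublinear p"
    unfolding sublinear_def using add by (simp add: scaleR_scaleC scale)
  then obtain g where g: "linear g" "\<And>x. g x \<le> p x" "g b = p b"
    using hahn_banach_sublinear[of p b] by metis
  have neg: "p (- x) = p x" for x
    using scale[of "- 1" x] scaleR_scaleC[of "- 1" x] by simp
  have abs: "\<bar>g x\<bar> \<le> p x" for x
    using g(2)[of x] g(2)[of "- x"] linear_neg[OF g(1), of x] neg[of x] by simp
  \<comment> \<open>The complex-linear functional with real part \<open>g\<close>.\<close>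
  define \<psi> where "\<psi> x = Complex (g x) (- g (\<i> *\<^sub>C x))" for x
  have scR: "g (complex_of_real t *\<^sub>C x) = t * g x" for t x
    using linear_cmul[OF g(1), of t x] by (simp add: scaleR_scaleC)
  have C: "g (c *\<^sub>C x) = Re c * g x + Im c * g (\<i> *\<^sub>C x)" for c x
  proof -
    have "c *\<^sub>C x = complex_of_real (Re c) *\<^sub>C x + complex_of_real (Im c) *\<^sub>C (\<i> *\<^sub>C x)"
      by (simp add: scaleC_scaleC scaleC_add_left[symmetric] complex_eq[of c, symmetric] mult.commute)
    then show ?thesis by (simp add: linear_add[OF g(1)] scR)
  qed
  have bnd: "cmod (\<psi> x) \<le> 2 * p x" for x
  proof -
    have "cmod (\<psi> x) \<le> \<bar>g x\<bar> + \<bar>g (\<i> *\<^sub>C x)\<bar>"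
      using cmod_le[of "\<psi> x"] by (simp add: \<psi>_def)
    also have "\<dots> \<le> p x + p (\<i> *\<^sub>C x)" by (intro add_mono abs)
    finally show ?thesis by (simp add: scale)
  qed
  have "\<psi> \<in> cdual"
  proof (rule cdualI[of _ "2 * K"])
    show "\<psi> (x + y) = \<psi> x + \<psi> y" for x y
      by (simp add: \<psi>_def scaleC_add_right linear_add[OF g(1)] complex_eq_iff)
    show "\<psi> (c *\<^sub>C x) = c * \<psi> x" for c x
      using C[of c x] C[of "\<i> * c" x] by (simp add: \<psi>_def scaleC_scaleC complex_eq_iff algebra_simps)
    show "cmod (\<psi> x) \<le> norm x * (2 * K)" for x
      using bnd[of x] bound[of x] by (simp add: algebra_simps)
  qed
  moreover have "Re (\<psi> b) = p b" by (simp add: \<psi>_def g(3))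
  ultimately show ?thesis using bnd by (intro bexI[of _ \<psi>]) auto
qed

section \<open>An ultrafilter for the reversible part\<close>

lemma wap_twist:
  assumes a: "wap a" and z: "cmod z = 1"
  shows "wap (\<lambda>n. z ^ n * a n)"
proof -
  obtain C where C: "\<And>n. cmod (a n) \<le> C" using a by (auto simp: wap_def bounded_range_iff)
  have bz: "bounded (range (\<lambda>n. z ^ n))"
    using z by (auto simp: bounded_range_iff norm_power)
  have ba: "bounded (range (\<lambda>n. a (k + n)))" "bounded (range (\<lambda>k. a (k + n)))" for k n
    using C by (auto simp: bounded_range_iff)
  have bL: "bounded (range (\<lambda>k. Lim U (\<lambda>n. a (k + n))))" "bounded (range (\<lambda>n. Lim U (\<lambda>k. a (k + n))))"
    if "ultrafilter U" for U :: "nat filter"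
    unfolding bounded_range_iff using C that by (auto intro!: exI[of _ C] ultrafilter_norm_Lim_le)
  show ?thesis
    unfolding wap_def
  proof (intro conjI allI impI)
    show "bounded (range (\<lambda>n. z ^ n * a n))"
      using C z by (auto simp: bounded_range_iff norm_mult norm_power)
    fix U V :: "nat filter" assume U: "ultrafilter U" and V: "ultrafilter V"
    note conv = ultrafilter_convergent
    have 1: "Lim V (\<lambda>n. z ^ (k + n) * a (k + n)) = z ^ k * (Lim V (\<lambda>n. z ^ n) * Lim V (\<lambda>n. a (k + n)))" for k
      unfolding power_add mult.assoc
      by (intro ultrafilter_LimI[OF V] tendsto_mult tendsto_const conv[OF V] bz ba)
    have 2: "Lim U (\<lambda>k. z ^ (k + n) * a (k + n)) = z ^ n * (Lim U (\<lambda>k. z ^ k) * Lim U (\<lambda>k. a (k + n)))" for n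
      unfolding power_add mult.assoc mult.left_commute[of "z ^ _" "z ^ n"]
      by (intro ultrafilter_LimI[OF U] tendsto_mult tendsto_const conv[OF U] bz ba)
    have "Lim U (\<lambda>k. Lim V (\<lambda>n. z ^ (k + n) * a (k + n)))
        = Lim U (\<lambda>k. z ^ k) * (Lim V (\<lambda>n. z ^ n) * Lim U (\<lambda>k. Lim V (\<lambda>n. a (k + n))))"
      unfolding 1 by (intro ultrafilter_LimI[OF U] tendsto_mult tendsto_const conv[OF U] bz bL[OF V])
    also have "Lim U (\<lambda>k. Lim V (\<lambda>n. a (k + n))) = Lim V (\<lambda>n. Lim U (\<lambda>k. a (k + n)))"
      using a U V by (simp add: wap_def)
    also have "Lim U (\<lambda>k. z ^ k) * (Lim V (\<lambda>n. z ^ n) * \<dots>)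
        = Lim V (\<lambda>n. z ^ n) * (Lim U (\<lambda>k. z ^ k) * \<dots>)" by (simp add: mult_ac)
    also have "\<dots> = Lim V (\<lambda>n. Lim U (\<lambda>k. z ^ (k + n) * a (k + n)))"
      unfolding 2 by (intro ultrafilter_LimI[OF V, symmetric] tendsto_mult tendsto_const conv[OF V] bz bL[OF U])
    finally show "Lim U (\<lambda>k. Lim V (\<lambda>n. z ^ (k + n) * a (k + n)))
        = Lim V (\<lambda>n. Lim U (\<lambda>k. z ^ (k + n) * a (k + n)))" .
  qed
qed

definition null_set :: "nat set \<Rightarrow> bool"
  where "null_set A \<longleftrightarrow> (\<lambda>N. avg 0 N (indicat_real A)) \<longlonglongrightarrow> 0"

lemma null_set_mono:
  assumes "null_set A" "B \<subseteq> A"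
  shows "null_set B"
  unfolding null_set_def
proof (rule Lim_null_comparison)
  show "eventually (\<lambda>N. norm (avg 0 N (indicat_real B)) \<le> avg 0 N (indicat_real A)) sequentially"
  proof (intro always_eventually allI)
    fix N
    have "0 \<le> avg 0 N (indicat_real B)" by (simp add: avg_def sum_nonneg)
    moreover have "avg 0 N (indicat_real B) \<le> avg 0 N (indicat_real A)"
      using assms(2) by (intro avg_mono) (auto simp: indicator_def)
    ultimately show "norm (avg 0 N (indicat_real B)) \<le> avg 0 N (indicat_real A)" by simp
  qed
qed (use assms in \<open>simp add: null_set_def\<close>)

lemma null_set_Un:
  assumes "null_set A" "null_set B"
  shows "null_set (A \<union> B)"
  unfolding null_set_def
proof (rule Lim_null_comparison)
  show "eventually (\<lambda>N. norm (avg 0 N (indicat_real (A \<union> B)))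
      \<le> avg 0 N (indicat_real A) + avg 0 N (indicat_real B)) sequentially"
  proof (intro always_eventually allI)
    fix N
    have "0 \<le> avg 0 N (indicat_real (A \<union> B))" by (simp add: avg_def sum_nonneg)
    moreover have "avg 0 N (indicat_real (A \<union> B)) \<le> avg 0 N (\<lambda>n. indicat_real A n + indicat_real B n)"
      by (intro avg_mono) (auto simp: indicator_def)
    ultimately show "norm (avg 0 N (indicat_real (A \<union> B))) \<le> avg 0 N (indicat_real A) + avg 0 N (indicat_real B)"
      by (simp add: avg_add)
  qed
  show "(\<lambda>N. avg 0 N (indicat_real A) + avg 0 N (indicat_real B)) \<longlonglongrightarrow> 0"
    using tendsto_add[OF assms[unfolded null_set_def]] by simp
qed

lemma null_set_translate:
  assumes "null_set A"
  shows "null_set {k. k < l \<or> k - l \<in> A}"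
  unfolding null_set_def
proof (rule Lim_null_comparison)
  show "eventually (\<lambda>N. norm (avg 0 N (indicat_real {k. k < l \<or> k - l \<in> A}))
      \<le> real l / real N + avg 0 N (indicat_real A)) sequentially"
  proof (intro always_eventually allI)
    fix N
    have "(\<Sum>k<N. indicat_real {k. k < l \<or> k - l \<in> A} k) \<le> real l + (\<Sum>k<N. indicat_real A k)"
    proof -
      have "(\<Sum>k<N. indicat_real {k. k < l \<or> k - l \<in> A} k)
          \<le> (\<Sum>k<l + N. indicat_real {k. k < l \<or> k - l \<in> A} k)"
        by (rule sum_mono2) auto
      also have "\<dots> = (\<Sum>k<l. indicat_real {k. k < l \<or> k - l \<in> A} k) + (\<Sum>k<N. indicat_real A k)"
      proof (induction N)
        case (Suc N)
        then show ?case by (simp add: indicator_def)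
      qed simp
      also have "(\<Sum>k<l. indicat_real {k. k < l \<or> k - l \<in> A} k) = real l" by simp
      finally show ?thesis .
    qed
    then have "(\<Sum>k<N. indicat_real {k. k < l \<or> k - l \<in> A} k) / N \<le> (real l + (\<Sum>k<N. indicat_real A k)) / N"
      by (rule divide_right_mono) simp
    moreover have "0 \<le> (\<Sum>k<N. indicat_real {k. k < l \<or> k - l \<in> A} k) / N"
      by (simp add: sum_nonneg)
    ultimately show "norm (avg 0 N (indicat_real {k. k < l \<or> k - l \<in> A}))
        \<le> real l / real N + avg 0 N (indicat_real A)"
      by (simp add: avg_def distrib_left divide_inverse_commute)
  qed
  show "(\<lambda>N. real l / real N + avg 0 N (indicat_real A)) \<longlonglongrightarrow> 0"
    using tendsto_add[OF lim_const_over_n[of "real l"] assms[unfolded null_set_def]] by simp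
qed

lemma null_set_large_values:
  fixes f :: "nat \<Rightarrow> complex"
  assumes f: "(\<lambda>N. avg 0 N (\<lambda>n. cmod (f n))) \<longlonglongrightarrow> 0" and e: "0 < e"
  shows "null_set {n. e \<le> cmod (f n)}"
  unfolding null_set_def
proof (rule Lim_null_comparison)
  show "eventually (\<lambda>N. norm (avg 0 N (indicat_real {n. e \<le> cmod (f n)}))
      \<le> inverse e * avg 0 N (\<lambda>n. cmod (f n))) sequentially"
  proof (intro always_eventually allI)
    fix N
    have "avg 0 N (indicat_real {n. e \<le> cmod (f n)}) \<le> avg 0 N (\<lambda>n. inverse e * cmod (f n))"
      using e by (intro avg_mono) (auto simp: indicator_def field_simps)
    moreover have "0 \<le> avg 0 N (indicat_real {n. e \<le> cmod (f n)})" by (simp add: avg_def sum_nonneg)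
    ultimately show "norm (avg 0 N (indicat_real {n. e \<le> cmod (f n)})) \<le> inverse e * avg 0 N (\<lambda>n. cmod (f n))"
      by (simp add: avg_mult_left)
  qed
  show "(\<lambda>N. inverse e * avg 0 N (\<lambda>n. cmod (f n))) \<longlonglongrightarrow> 0"
    using tendsto_mult_right_zero[OF f] by simp
qed

text \<open>
  Let \<open>V\<close> be an ultrafilter that contains every set of density one, and let \<open>U\<close> be the difference
  \<open>V - V\<close>: a set belongs to \<open>U\<close> if \<open>k - l\<close> lies in it for \<open>V\<close>-almost all \<open>k\<close>, for \<open>V\<close>-almost all \<open>l\<close>. Then \<open>U\<close> contains
  the sets of density one, since these are stable under translation. Moreover \<open>z ^ k\<close> converges along \<open>V\<close>
  to some \<open>w\<close> of modulus one, hence along \<open>U\<close> to \<open>w / w = 1\<close>.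
\<close>

theorem difference_ultrafilter:
  obtains U :: "nat filter" where "ultrafilter U"
    "\<And>z::complex. cmod z = 1 \<Longrightarrow> ((\<lambda>k. z ^ k) \<longlongrightarrow> 1) U"
    "\<And>f::nat \<Rightarrow> complex. (\<lambda>N. avg 0 N (\<lambda>n. cmod (f n))) \<longlonglongrightarrow> 0 \<Longrightarrow> (f \<longlongrightarrow> 0) U"
proof -
  define F where "F = Abs_filter (\<lambda>P. null_set {n. \<not> P n})"
  have null_empty: "null_set {}" by (simp add: null_set_def avg_def)
  have isF: "is_filter (\<lambda>P. null_set {n. \<not> P n})"
  proof
    show "null_set {n. \<not> True}" using null_empty by simp
    show "null_set {n. \<not> (P n \<and> Q n)}" if "null_set {n. \<not> P n}" "null_set {n. \<not> Q n}" for P Q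
      using null_set_Un[OF that] by (simp add: Collect_disj_eq[symmetric])
    show "null_set {n. \<not> Q n}" if "\<forall>n. P n \<longrightarrow> Q n" "null_set {n. \<not> P n}" for P Q
      by (rule null_set_mono[OF that(2)]) (use that(1) in auto)
  qed
  have F: "eventually P F \<longleftrightarrow> null_set {n. \<not> P n}" for P
    unfolding F_def by (rule eventually_Abs_filter[OF isF])
  have "\<not> null_set UNIV"
  proof
    assume "null_set UNIV"
    moreover have "(\<lambda>N. avg 0 N (indicat_real UNIV)) \<longlonglongrightarrow> 1"
    proof (rule tendsto_eventually)
      show "eventually (\<lambda>N. avg 0 N (indicat_real UNIV) = 1) sequentially"
        using eventually_gt_at_top[of 0] by eventually_elim (simp add: avg_def)
    qed
    ultimately show False unfolding null_set_def using LIMSEQ_unique by fastforce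
  qed
  then have "F \<noteq> bot" by (simp add: trivial_limit_def F)
  then obtain V where V: "V \<le> F" "ultrafilter V" by (rule ultrafilter_exists)
  define U where "U = Abs_filter (\<lambda>P. eventually (\<lambda>l. eventually (\<lambda>k. P (k - l)) V) V)"
  have isU: "is_filter (\<lambda>P. eventually (\<lambda>l. eventually (\<lambda>k. P (k - l)) V) V)"
    by unfold_locales (auto simp: eventually_conj_iff elim!: eventually_mono)
  have U: "eventually P U \<longleftrightarrow> eventually (\<lambda>l. eventually (\<lambda>k. P (k - l)) V) V" for P
    unfolding U_def by (rule eventually_Abs_filter[OF isU])
  have ge: "eventually (\<lambda>k. l \<le> k) V" for l
  proof (rule filter_leD[OF V(1)])
    show "eventually (\<lambda>k. l \<le> k) F"
      unfolding F by (rule null_set_mono[OF null_set_translate[OF null_empty, of l]]) auto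
  qed
  have ultraU: "ultrafilter U"
    unfolding ultrafilter_def
  proof (intro conjI allI)
    show "U \<noteq> bot"
      using ultrafilter_not_bot[OF V(2)] by (simp add: trivial_limit_def U)
    show "eventually P U \<or> eventually (\<lambda>x. \<not> P x) U" for P
      unfolding U ultrafilter_not_eventually[OF V(2), symmetric] by blast
  qed
  have power: "((\<lambda>k. z ^ k) \<longlongrightarrow> 1) U" if z: "cmod z = 1" for z :: complex
  proof (rule tendstoI)
    fix e :: real assume e: "0 < e"
    have "bounded (range (\<lambda>k. z ^ k))" using z by (auto simp: bounded_range_iff norm_power)
    then have "((\<lambda>k. z ^ k) \<longlongrightarrow> Lim V (\<lambda>k. z ^ k)) V" by (rule ultrafilter_convergent[OF V(2)])
    then have near: "eventually (\<lambda>k. dist (z ^ k) (Lim V (\<lambda>k. z ^ k)) < e / 2) V"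
      using e by (intro tendstoD) auto
    then have "eventually (\<lambda>l. eventually (\<lambda>k. dist (z ^ (k - l)) 1 < e) V) V"
    proof eventually_elim
      case (elim l)
      show ?case using near ge[of l]
      proof eventually_elim
        case (elim k)
        have "z ^ k - z ^ l = z ^ l * (z ^ (k - l) - 1)"
          using elim(2) by (simp add: algebra_simps flip: power_add)
        then have "cmod (z ^ k - z ^ l) = cmod (z ^ (k - l) - 1)"
          using z by (simp add: norm_mult norm_power)
        moreover have "dist (z ^ k) (z ^ l) < e"
          using dist_triangle_half_l[OF elim(1) \<open>dist (z ^ l) (Lim V (\<lambda>k. z ^ k)) < e / 2\<close>] .
        ultimately show ?case by (simp add: dist_norm)
      qed
    qed
    then show "eventually (\<lambda>k. dist (z ^ k) 1 < e) U" unfolding U .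
  qed
  have null: "(f \<longlongrightarrow> 0) U" if f: "(\<lambda>N. avg 0 N (\<lambda>n. cmod (f n))) \<longlonglongrightarrow> 0" for f :: "nat \<Rightarrow> complex"
  proof (rule tendstoI)
    fix e :: real assume e: "0 < e"
    have "eventually (\<lambda>k. dist (f (k - l)) 0 < e) V" for l
    proof (rule filter_leD[OF V(1)])
      show "eventually (\<lambda>k. dist (f (k - l)) 0 < e) F"
        unfolding F
        by (rule null_set_mono[OF null_set_translate[OF null_set_large_values[OF f e], of l]]) auto
    qed
    then show "eventually (\<lambda>k. dist (f k) 0 < e) U" unfolding U by simp
  qed
  show thesis by (rule that[OF ultraU power null])
qed

section \<open>Distance to the almost periodic sequences\<close>

lemma trig_polynomial_monomial: "cmod z = 1 \<Longrightarrow> trig_polynomial (\<lambda>n. c * z ^ n)"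
  unfolding trig_polynomial_def by (intro exI[of _ "{z}"] exI[of _ "\<lambda>_. c"]) auto

lemma trig_polynomial_mult:
  assumes "trig_polynomial p"
  shows "trig_polynomial (\<lambda>n. c * p n)"
proof -
  obtain \<Lambda> k where "finite \<Lambda>" "\<Lambda> \<subseteq> {z. cmod z = 1}" "\<forall>n\<ge>1. p n = (\<Sum>z\<in>\<Lambda>. k z * z ^ n)"
    using assms by (auto simp: trig_polynomial_def)
  then show ?thesis unfolding trig_polynomial_def
    by (intro exI[of _ \<Lambda>] exI[of _ "\<lambda>z. c * k z"]) (simp add: sum_distrib_left mult.assoc)
qed

lemma trig_polynomial_add:
  assumes "trig_polynomial p" "trig_polynomial q"
  shows "trig_polynomial (\<lambda>n. p n + q n)"
proof -
  obtain \<Lambda> k where p: "finite \<Lambda>" "\<Lambda> \<subseteq> {z. cmod z = 1}" "\<forall>n\<ge>1. p n = (\<Sum>z\<in>\<Lambda>. k z * z ^ n)"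
    using assms(1) by (auto simp: trig_polynomial_def)
  obtain \<Gamma> l where q: "finite \<Gamma>" "\<Gamma> \<subseteq> {z. cmod z = 1}" "\<forall>n\<ge>1. q n = (\<Sum>z\<in>\<Gamma>. l z * z ^ n)"
    using assms(2) by (auto simp: trig_polynomial_def)
  define k' l' where "k' z = (if z \<in> \<Lambda> then k z else 0)" and "l' z = (if z \<in> \<Gamma> then l z else 0)" for z
  have "p n + q n = (\<Sum>z\<in>\<Lambda> \<union> \<Gamma>. (k' z + l' z) * z ^ n)" if "1 \<le> n" for n
  proof -
    have "p n = (\<Sum>z\<in>\<Lambda>. k' z * z ^ n)" "q n = (\<Sum>z\<in>\<Gamma>. l' z * z ^ n)"
      using p(3) q(3) that by (auto simp: k'_def l'_def)
    moreover have "(\<Sum>z\<in>\<Lambda>. k' z * z ^ n) = (\<Sum>z\<in>\<Lambda> \<union> \<Gamma>. k' z * z ^ n)"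
      "(\<Sum>z\<in>\<Gamma>. l' z * z ^ n) = (\<Sum>z\<in>\<Lambda> \<union> \<Gamma>. l' z * z ^ n)"
      using p(1) q(1) by (intro sum.mono_neutral_left; auto simp: k'_def l'_def)+
    ultimately show ?thesis by (simp add: sum.distrib distrib_right)
  qed
  then show ?thesis unfolding trig_polynomial_def
    using p q by (intro exI[of _ "\<Lambda> \<union> \<Gamma>"] exI[of _ "\<lambda>z. k' z + l' z"]) auto
qed

text \<open>
  The sup-norm distance to the trigonometric polynomials, over the positive indices.
\<close>

definition ap_dist :: "(nat \<Rightarrow> complex) \<Rightarrow> real"
  where "ap_dist a = Inf {e. 0 \<le> e \<and> (\<exists>q. trig_polynomial q \<and> (\<forall>n\<ge>1. cmod (a n - q n) \<le> e))}"

lemma ap_dist_le: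
  assumes "trig_polynomial q" "\<And>n. 1 \<le> n \<Longrightarrow> cmod (a n - q n) \<le> e"
  shows "ap_dist a \<le> e"
proof -
  have "0 \<le> e" using assms(2)[of 1] norm_ge_zero order_trans by blast
  then show ?thesis
    unfolding ap_dist_def using assms by (intro cInf_lower bdd_belowI[of _ 0]) auto
qed

lemma ap_dist_bound: "(\<And>n. cmod (a n) \<le> C) \<Longrightarrow> ap_dist a \<le> C"
  using ap_dist_le[of "\<lambda>n. 0 * 1 ^ n" a C] trig_polynomial_monomial[of 1 0] by simp

lemma ap_dist_approx:
  assumes "\<And>n. cmod (a n) \<le> C" "ap_dist a < d"
  shows "\<exists>q. trig_polynomial q \<and> (\<forall>n\<ge>1. cmod (a n - q n) \<le> d)"
proof -
  have "0 \<le> C" using assms(1)[of 0] norm_ge_zero order_trans by blast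
  then have "{e. 0 \<le> e \<and> (\<exists>q. trig_polynomial q \<and> (\<forall>n\<ge>1. cmod (a n - q n) \<le> e))} \<noteq> {}"
    using assms(1) trig_polynomial_monomial[of 1 0] by (auto intro!: exI[of _ C] exI[of _ "\<lambda>n. 0"])
  from cInf_lessD[OF this assms(2)[unfolded ap_dist_def]]
  obtain e q where "e < d" "trig_polynomial q" "\<forall>n\<ge>1. cmod (a n - q n) \<le> e"
    by blast
  then show ?thesis by (intro exI[of _ q]) (auto intro: order_trans)
qed

lemma ap_dist_add:
  assumes a: "\<And>n. cmod (a n) \<le> C" and b: "\<And>n. cmod (b n) \<le> C"
  shows "ap_dist (\<lambda>n. a n + b n) \<le> ap_dist a + ap_dist b"
proof (rule field_le_epsilon)
  fix e :: real assume e: "0 < e"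
  obtain q r where q: "trig_polynomial q" "\<forall>n\<ge>1. cmod (a n - q n) \<le> ap_dist a + e / 2"
    and r: "trig_polynomial r" "\<forall>n\<ge>1. cmod (b n - r n) \<le> ap_dist b + e / 2"
    using ap_dist_approx[of a C "ap_dist a + e / 2", OF a] ap_dist_approx[of b C "ap_dist b + e / 2", OF b] e
    by auto
  have "cmod (a n + b n - (q n + r n)) \<le> ap_dist a + ap_dist b + e" if "1 \<le> n" for n
  proof -
    have "cmod (a n + b n - (q n + r n)) \<le> cmod (a n - q n) + cmod (b n - r n)"
      using norm_triangle_ineq[of "a n - q n" "b n - r n"] by (simp add: algebra_simps)
    moreover have "cmod (a n - q n) \<le> ap_dist a + e / 2" "cmod (b n - r n) \<le> ap_dist b + e / 2"
      using q(2) r(2) that by auto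
    ultimately show ?thesis by linarith
  qed
  then show "ap_dist (\<lambda>n. a n + b n) \<le> ap_dist a + ap_dist b + e"
    by (rule ap_dist_le[OF trig_polynomial_add[OF q(1) r(1)]])
qed

lemma ap_dist_mult:
  assumes a: "\<And>n. cmod (a n) \<le> C"
  shows "ap_dist (\<lambda>n. c * a n) = cmod c * ap_dist a"
proof -
  have nonneg: "0 \<le> ap_dist a" if "\<And>n. cmod (a n) \<le> C" for a C
  proof (rule ccontr)
    assume "\<not> 0 \<le> ap_dist a"
    then have "ap_dist a < ap_dist a / 2" by simp
    from ap_dist_approx[OF that this] obtain q where "\<forall>n\<ge>1. cmod (a n - q n) \<le> ap_dist a / 2" by auto
    then have "cmod (a 1 - q 1) \<le> ap_dist a / 2" by simp
    with \<open>\<not> 0 \<le> ap_dist a\<close> show False using norm_ge_zero[of "a 1 - q 1"] by linarith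
  qed
  have le: "ap_dist (\<lambda>n. c * a n) \<le> cmod c * ap_dist a" if a: "\<And>n. cmod (a n) \<le> C" and c: "c \<noteq> 0" for a C c
  proof (rule field_le_epsilon)
    fix e :: real assume e: "0 < e"
    have "ap_dist a < ap_dist a + e / cmod c" using e c by simp
    from ap_dist_approx[OF a this] obtain q where
      q: "trig_polynomial q" "\<forall>n\<ge>1. cmod (a n - q n) \<le> ap_dist a + e / cmod c" by auto
    have "cmod (c * a n - c * q n) \<le> cmod c * ap_dist a + e" if "1 \<le> n" for n
    proof -
      have "cmod (c * a n - c * q n) = cmod c * cmod (a n - q n)"
        by (simp add: norm_mult flip: right_diff_distrib)
      also have "\<dots> \<le> cmod c * (ap_dist a + e / cmod c)"
        using q(2) that by (intro mult_left_mono) auto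
      also have "\<dots> = cmod c * ap_dist a + e" using c by (simp add: distrib_left)
      finally show ?thesis .
    qed
    then show "ap_dist (\<lambda>n. c * a n) \<le> cmod c * ap_dist a + e"
      by (rule ap_dist_le[OF trig_polynomial_mult[OF q(1)]])
  qed
  show ?thesis
  proof (cases "c = 0")
    case True
    have "ap_dist (\<lambda>n. 0) = 0"
      using ap_dist_bound[of "\<lambda>n. 0" 0] nonneg[of "\<lambda>n. 0" 0] by simp
    with True show ?thesis by simp
  next
    case False
    have ca: "cmod (c * a n) \<le> cmod c * C" for n
      using a by (simp add: norm_mult mult_left_mono)
    have "ap_dist a \<le> inverse (cmod c) * ap_dist (\<lambda>n. c * a n)"
      using le[OF ca, of "inverse c"] False by (simp add: norm_inverse mult.assoc[symmetric])
    then have "cmod c * ap_dist a \<le> ap_dist (\<lambda>n. c * a n)"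
      using False by (simp add: field_simps)
    with le[of a C c, OF a False] show ?thesis by simp
  qed
qed

lemma almost_periodic_if_ap_dist_zero:
  assumes a: "\<And>n. cmod (a n) \<le> C" and zero: "ap_dist a = 0"
  shows "almost_periodic a"
proof -
  have "\<forall>j. \<exists>q. trig_polynomial q \<and> (\<forall>n\<ge>1. cmod (a n - q n) \<le> inverse (Suc j))"
    using ap_dist_approx[OF a] zero by simp
  then obtain p where p: "\<And>j. trig_polynomial (p j) \<and> (\<forall>n\<ge>1. cmod (a n - p j n) \<le> inverse (Suc j))"
    unfolding choice_iff by auto
  have "uniform_limit {1..} p a sequentially"
  proof (rule uniform_limitI)
    fix e :: real assume "0 < e"
    then have "eventually (\<lambda>j. inverse (real (Suc j)) < e) sequentially"
      using order_tendstoD(2)[OF LIMSEQ_inverse_real_of_nat] by blast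
    then show "eventually (\<lambda>j. \<forall>n\<in>{1..}. dist (p j n) (a n) < e) sequentially"
    proof eventually_elim
      case (elim j)
      then show ?case using p[of j] by (auto simp: dist_norm norm_minus_commute intro: le_less_trans)
    qed
  qed
  with p show ?thesis unfolding almost_periodic_def by blast
qed

section \<open>The decomposition\<close>

context
  fixes T :: "'a::complex_banach \<Rightarrow> 'a" and \<phi> :: "'a \<Rightarrow> complex"
  assumes T: "rel_weakly_compact_operator T" and \<phi>: "\<phi> \<in> cdual"
begin

lemma power_linear: "linear (T ^^ n)" "(T ^^ n) (c *\<^sub>C z) = c *\<^sub>C (T ^^ n) z"
proof -
  have T': "linear T" "\<And>c z. T (c *\<^sub>C z) = c *\<^sub>C T z"
    using T by (auto simp: rel_weakly_compact_operator_def bounded_clinear_def bounded_linear.linear)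
  show "linear (T ^^ n)"
  proof (induction n)
    case (Suc n)
    show ?case unfolding funpow.simps(2) by (rule linear_compose[OF Suc T'(1)])
  qed (simp add: linear_id[unfolded id_def] id_def)
  show "(T ^^ n) (c *\<^sub>C z) = c *\<^sub>C (T ^^ n) z" by (induction n) (simp_all add: T')
qed

text \<open>
  The uniform mean of the twisted sequence says that some convex combination \<open>v\<close> of twisted points of
  the orbit produces the sequence \<open>\<beta> * z ^ n\<close>, up to a uniformly small error. A functional dominated by the
  distance to the trigonometric polynomials is therefore small at \<open>v\<close>, and its value at \<open>v\<close> is the
  average in question.
\<close>

lemma fourier_zero_if_dominated:
  assumes \<psi>: "\<psi> \<in> cdual" and dom: "\<And>v. cmod (\<psi> v) \<le> 2 * ap_dist (\<lambda>n. \<phi> ((T ^^ n) v))"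
    and z: "cmod z = 1"
  shows "uniform_limit UNIV (\<lambda>N m. avg m N (\<lambda>n. cnj z ^ n * \<psi> ((T ^^ n) x))) (\<lambda>_. 0) sequentially"
proof -
  define a where "a n = cnj z ^ n * \<phi> ((T ^^ n) x)" for n
  have "wap a" unfolding a_def
    by (rule wap_twist[OF linear_sequence_wap[OF T \<phi>]]) (simp add: z)
  then obtain \<beta> where \<beta>: "uniform_limit UNIV (\<lambda>N m. avg m N a) (\<lambda>_. \<beta>) sequentially"
    by (rule wap_uniform_mean)
  have zz: "z * cnj z = 1" using z by (simp add: complex_norm_square[symmetric])
  show ?thesis
  proof (rule uniform_limitI)
    fix e :: real assume e: "0 < e"
    then have "eventually (\<lambda>N. \<forall>m\<in>UNIV. dist (avg m N a) \<beta> < e / 3) sequentially"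
      by (intro uniform_limitD[OF \<beta>]) simp
    then show "eventually (\<lambda>N. \<forall>m\<in>UNIV. dist (avg m N (\<lambda>n. cnj z ^ n * \<psi> ((T ^^ n) x))) 0 < e) sequentially"
    proof eventually_elim
      case (elim N)
      have "cmod (avg m N (\<lambda>n. cnj z ^ n * \<psi> ((T ^^ n) x))) < e" for m
      proof -
        \<comment> \<open>A single vector whose image under every functional is the corresponding average.\<close>
        define v where "v = (\<Sum>k<N. (cnj z ^ (m + k) / of_nat N) *\<^sub>C (T ^^ (m + k)) x)"
        have apply_v: "\<xi> v = avg m N (\<lambda>n. cnj z ^ n * \<xi> ((T ^^ n) x))" if \<xi>: "\<xi> \<in> cdual" for \<xi>
          unfolding v_def linear_sum[OF bounded_linear.linear[OF cdual_linear[OF \<xi>]]]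
            cdual_scaleC[OF \<xi>] avg_def scaleR_conv_of_real sum_distrib_left
          by (intro sum.cong refl) (simp add: divide_inverse)
        have "cmod (\<phi> ((T ^^ n) v) - \<beta> * z ^ n) \<le> e / 3" for n
        proof -
          have "\<phi> ((T ^^ n) v) = avg m N (\<lambda>j. cnj z ^ j * \<phi> ((T ^^ n) ((T ^^ j) x)))"
            by (rule apply_v[OF power_cdual[OF T \<phi>]])
          also have "(\<lambda>j. cnj z ^ j * \<phi> ((T ^^ n) ((T ^^ j) x))) = (\<lambda>j. z ^ n * a (j + n))"
          proof
            fix j
            have "z ^ n * a (j + n) = (z * cnj z) ^ n * (cnj z ^ j * \<phi> ((T ^^ (n + j)) x))"
              by (simp add: a_def power_add power_mult_distrib mult_ac add.commute)
            then show "cnj z ^ j * \<phi> ((T ^^ n) ((T ^^ j) x)) = z ^ n * a (j + n)"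
              by (simp add: zz funpow_add)
          qed
          also have "avg m N \<dots> = z ^ n * avg (m + n) N a" by (simp add: avg_mult_left avg_shift_arg)
          finally have "\<phi> ((T ^^ n) v) - \<beta> * z ^ n = z ^ n * (avg (m + n) N a - \<beta>)"
            by (simp add: algebra_simps)
          then have "cmod (\<phi> ((T ^^ n) v) - \<beta> * z ^ n) = dist (avg (m + n) N a) \<beta>"
            using z by (simp add: norm_mult norm_power dist_norm)
          with elim show ?thesis by (simp add: less_imp_le)
        qed
        then have "ap_dist (\<lambda>n. \<phi> ((T ^^ n) v)) \<le> e / 3"
          by (intro ap_dist_le[OF trig_polynomial_monomial[OF z]])
        with dom[of v] e have "cmod (\<psi> v) < e" by linarith
        then show ?thesis by (simp add: apply_v[OF \<psi>])
      qed
      then show ?case by simp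
    qed
  qed
qed

text \<open>
  Almost periodicity of \<open>\<phi> ((T ^^ n) y)\<close>: by Hahn-Banach it suffices that \<open>\<psi> y = 0\<close> for each
  functional \<open>\<psi>\<close> dominated by the distance to the trigonometric polynomials. For such \<open>\<psi>\<close>, the
  sequence \<open>\<psi> ((T ^^ k) x)\<close> has no Fourier coefficients; by Wiener's lemma it tends to zero in density, hence
  along \<open>U\<close>, where its limit is \<open>\<psi> y\<close>.

  Nullity of the difference: since \<open>z ^ k\<close> tends to \<open>1\<close> along \<open>U\<close>, the sequences given by \<open>x\<close> and \<open>y\<close> have the
  same Fourier coefficients, and Wiener's lemma applies to the sequence given by \<open>x - y\<close>.
\<close>

lemma weak_limit_decomposition:
  assumes U: "ultrafilter U"
    and power: "\<And>z::complex. cmod z = 1 \<Longrightarrow> ((\<lambda>k. z ^ k) \<longlongrightarrow> 1) U"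
    and null: "\<And>f::nat \<Rightarrow> complex. (\<lambda>N. avg 0 N (\<lambda>n. cmod (f n))) \<longlonglongrightarrow> 0 \<Longrightarrow> (f \<longlongrightarrow> 0) U"
    and y: "\<And>\<psi>. \<psi> \<in> cdual \<Longrightarrow> ((\<lambda>k. \<psi> ((T ^^ k) x)) \<longlongrightarrow> \<psi> y) U"
  shows weak_limit_almost_periodic: "almost_periodic (\<lambda>n. \<phi> ((T ^^ n) y))"
    and difference_null: "(\<lambda>N. avg m N (\<lambda>n. cmod (\<phi> ((T ^^ n) (x - y))))) \<longlonglongrightarrow> 0"
proof -
  obtain C where C: "0 \<le> C" "\<And>n v. cmod (\<phi> ((T ^^ n) v)) \<le> C * norm v"
    using orbit_norm_bound[OF T \<phi>] by auto
  define p where "p v = ap_dist (\<lambda>n. \<phi> ((T ^^ n) v))" for v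
  have "p y = 0"
  proof -
    note lin = bounded_linear.linear[OF cdual_linear[OF power_cdual[OF T \<phi>]]]
    have "\<exists>\<psi>\<in>cdual. (\<forall>v. cmod (\<psi> v) \<le> 2 * p v) \<and> Re (\<psi> y) = p y"
    proof (rule hahn_banach_cdual[of p C y])
      fix v w c
      have "cmod (\<phi> ((T ^^ n) v)) \<le> max (C * norm v) (C * norm w)"
        "cmod (\<phi> ((T ^^ n) w)) \<le> max (C * norm v) (C * norm w)" for n
        using C(2) by (auto simp: le_max_iff_disj)
      then show "p (v + w) \<le> p v + p w"
        unfolding p_def linear_add[OF lin] by (rule ap_dist_add)
      show "p (c *\<^sub>C v) = cmod c * p v"
        unfolding p_def cdual_scaleC[OF power_cdual[OF T \<phi>]] by (rule ap_dist_mult[OF C(2)])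
      show "p v \<le> C * norm v"
        unfolding p_def by (rule ap_dist_bound[OF C(2)])
    qed
    then obtain \<psi> where \<psi>: "\<psi> \<in> cdual" "\<And>v. cmod (\<psi> v) \<le> 2 * p v" "Re (\<psi> y) = p y"
      by auto
    have "(\<lambda>N. avg 0 N (\<lambda>n. cmod (\<psi> ((T ^^ n) x)))) \<longlonglongrightarrow> 0"
      by (rule cesaro_null_if_fourier_zero[OF linear_sequence_wap[OF T \<psi>(1)]])
        (rule fourier_zero_if_dominated[OF \<psi>(1) \<psi>(2)[unfolded p_def]])
    then have "((\<lambda>k. \<psi> ((T ^^ k) x)) \<longlongrightarrow> 0) U" by (rule null)
    with y[OF \<psi>(1)] have "\<psi> y = 0"
      using tendsto_unique ultrafilter_not_bot[OF U] by blast
    with \<psi>(3) show ?thesis by simp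
  qed
  then show "almost_periodic (\<lambda>n. \<phi> ((T ^^ n) y))"
    unfolding p_def by (rule almost_periodic_if_ap_dist_zero[OF C(2)])
  show "(\<lambda>N. avg m N (\<lambda>n. cmod (\<phi> ((T ^^ n) (x - y))))) \<longlonglongrightarrow> 0"
  proof (rule cesaro_null_if_fourier_zero[OF linear_sequence_wap[OF T \<phi>]])
    fix z :: complex assume z: "cmod z = 1"
    define a where "a n = cnj z ^ n * \<phi> ((T ^^ n) x)" for n
    define b where "b n = cnj z ^ n * \<phi> ((T ^^ n) y)" for n
    have "wap a" unfolding a_def
      by (rule wap_twist[OF linear_sequence_wap[OF T \<phi>]]) (simp add: z)
    then obtain \<beta> where \<beta>: "uniform_limit UNIV (\<lambda>N m. avg m N a) (\<lambda>_. \<beta>) sequentially"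
      by (rule wap_uniform_mean)
    have zz: "z * cnj z = 1" using z by (simp add: complex_norm_square[symmetric])
    have conv: "((\<lambda>k. z ^ k * a (n + k)) \<longlongrightarrow> b n) U" for n
    proof -
      have "z ^ k * a (n + k) = cnj z ^ n * \<phi> ((T ^^ n) ((T ^^ k) x))" for k
      proof -
        have "z ^ k * a (n + k) = (z * cnj z) ^ k * (cnj z ^ n * \<phi> ((T ^^ (n + k)) x))"
          by (simp add: a_def power_add power_mult_distrib mult_ac)
        then show ?thesis by (simp add: zz funpow_add)
      qed
      then show ?thesis
        unfolding b_def by (simp only:) (intro tendsto_mult tendsto_const y[OF power_cdual[OF T \<phi>]])
    qed
    have diff: "avg m N (\<lambda>n. cnj z ^ n * \<phi> ((T ^^ n) (x - y))) = avg m N a - avg m N b" for m N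
      unfolding a_def b_def avg_diff[symmetric]
        linear_diff[OF bounded_linear.linear[OF cdual_linear[OF power_cdual[OF T \<phi>]]]]
      by (simp add: right_diff_distrib)
    show "uniform_limit UNIV (\<lambda>N m. avg m N (\<lambda>n. cnj z ^ n * \<phi> ((T ^^ n) (x - y)))) (\<lambda>_. 0) sequentially"
    proof (rule uniform_limitI)
      fix e :: real assume e: "0 < e"
      then have "eventually (\<lambda>N. \<forall>m\<in>UNIV. dist (avg m N a) \<beta> < e / 3) sequentially"
        by (intro uniform_limitD[OF \<beta>]) simp
      then show "eventually (\<lambda>N. \<forall>m\<in>UNIV. dist (avg m N (\<lambda>n. cnj z ^ n * \<phi> ((T ^^ n) (x - y)))) 0 < e) sequentially"
      proof eventually_elim
        case (elim N)
        have B: "cmod (avg m N b - \<beta>) \<le> e / 3" for m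
        proof (rule tendsto_upperbound[OF tendsto_norm])
          have "((\<lambda>k. avg m N (\<lambda>n. z ^ k * a (n + k))) \<longlongrightarrow> avg m N b) U"
            unfolding avg_def by (intro tendsto_intros conv)
          from tendsto_diff[OF this tendsto_mult[OF power[OF z] tendsto_const, of \<beta>]]
          show "((\<lambda>k. avg m N (\<lambda>n. z ^ k * a (n + k)) - z ^ k * \<beta>) \<longlongrightarrow> avg m N b - \<beta>) U" by simp
          show "eventually (\<lambda>k. cmod (avg m N (\<lambda>n. z ^ k * a (n + k)) - z ^ k * \<beta>) \<le> e / 3) U"
          proof (intro always_eventually allI)
            fix k
            have "avg m N (\<lambda>n. z ^ k * a (n + k)) - z ^ k * \<beta> = z ^ k * (avg (m + k) N a - \<beta>)"
              by (simp add: avg_mult_left avg_shift_arg right_diff_distrib)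
            then have "cmod (avg m N (\<lambda>n. z ^ k * a (n + k)) - z ^ k * \<beta>) = dist (avg (m + k) N a) \<beta>"
              using z by (simp add: norm_mult norm_power dist_norm)
            with elim show "cmod (avg m N (\<lambda>n. z ^ k * a (n + k)) - z ^ k * \<beta>) \<le> e / 3"
              by (simp add: less_imp_le)
          qed
        qed (rule ultrafilter_not_bot[OF U])
        have "cmod (avg m N a - avg m N b) < e" for m
        proof -
          have "cmod (avg m N a - avg m N b) \<le> cmod (avg m N a - \<beta>) + cmod (avg m N b - \<beta>)"
            using norm_triangle_ineq4[of "avg m N a - \<beta>" "avg m N b - \<beta>"] by simp
          moreover have "cmod (avg m N a - \<beta>) < e / 3" using elim by (simp add: dist_norm)
          ultimately show ?thesis using B[of m] e by linarith
        qed
        then show ?case by (simp add: diff)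
      qed
    qed
  qed
qed

end

theorem theorem2p2:
  fixes a :: "nat \<Rightarrow> complex"
  assumes "linear_sequence TYPE('a::complex_banach) a"
  shows "\<exists>b c :: nat \<Rightarrow> complex.
    almost_periodic b \<and>
    bounded (c ` {1..}) \<and>
    (\<lambda>N. (1 / real N) * (\<Sum>n=1..N. cmod (c n))) \<longlonglongrightarrow> 0 \<and>
    (\<forall>n\<ge>1. a n = b n + c n)"
proof -
  obtain T :: "'a \<Rightarrow> 'a" and x \<phi> where T: "rel_weakly_compact_operator T" and \<phi>: "\<phi> \<in> cdual"
    and a: "\<And>n. 1 \<le> n \<Longrightarrow> a n = \<phi> ((T ^^ n) x)"
    using assms by (auto simp: linear_sequence_def)
  obtain U :: "nat filter" where U: "ultrafilter U"
    "\<And>z::complex. cmod z = 1 \<Longrightarrow> ((\<lambda>k. z ^ k) \<longlongrightarrow> 1) U"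
    "\<And>f::nat \<Rightarrow> complex. (\<lambda>N. avg 0 N (\<lambda>n. cmod (f n))) \<longlonglongrightarrow> 0 \<Longrightarrow> (f \<longlongrightarrow> 0) U"
    using difference_ultrafilter by metis
  obtain y where y: "\<And>\<psi>. \<psi> \<in> cdual \<Longrightarrow> ((\<lambda>k. \<psi> ((T ^^ k) x)) \<longlongrightarrow> \<psi> y) U"
    using rel_weakly_compact_limit[OF orbit_compact[OF T] U(1)] by blast
  define b c where "b n = \<phi> ((T ^^ n) y)" and "c n = \<phi> ((T ^^ n) (x - y))" for n
  have "almost_periodic b"
    unfolding b_def by (rule weak_limit_almost_periodic[OF T \<phi> U y])
  moreover have "bounded (c ` {1..})"
    unfolding c_def
    by (rule bounded_subset[OF rel_weakly_compact_bounded[OF orbit_compact[OF T] \<phi>]]) auto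
  moreover have "(\<lambda>N. (1 / real N) * (\<Sum>n=1..N. cmod (c n))) \<longlonglongrightarrow> 0"
  proof -
    have "(\<Sum>n=1..N. cmod (c n)) = (\<Sum>k<N. cmod (c (1 + k)))" for N
      by (rule sum.reindex_bij_witness[of _ "\<lambda>k. 1 + k" "\<lambda>n. n - 1"]) auto
    then have "(1 / real N) * (\<Sum>n=1..N. cmod (c n)) = avg 1 N (\<lambda>n. cmod (c n))" for N
      by (simp add: avg_def divide_inverse)
    then show ?thesis
      using difference_null[OF T \<phi> U y, of 1] by (simp add: c_def)
  qed
  moreover have "a n = b n + c n" if "1 \<le> n" for n
    using linear_diff[OF bounded_linear.linear[OF cdual_linear[OF power_cdual[OF T \<phi>]]], of n x y]
    by (simp add: a[OF that] b_def c_def)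
  ultimately show ?thesis by blast
qed

end
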